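(* Let $(\mathcal I,\alpha^1\wedge\alpha^2)$ be the differential system of a deformation on $P=(G/\mathbb Z_2)\times\mathbb R^6\times\mathbb R^3$. Then the system is in involution in Cartan's sense, and its general integral submanifolds depend on six functions in one variable.
   Context: $\mathbb R^{4,2}$ is $\mathbb R^6$ (coordinates $x^0,\dots,x^5$) with the form $\langle X,Y\rangle=-(x^0y^5+x^5y^0)-(x^1y^4+x^4y^1)+x^2y^2+x^3y^3$, $G$ is the identity component of its linear isometry group, $\mathbb Z_2=\{\pm I\}$, and $\omega=A^{-1}dA=(\omega^I_J)_{0\le I,J\le5}$ is the Maurer--Cartan form, which descends to $G/\mathbb Z_2$ (here $dA_J=\omega^I_JA_I$ for the columns $A_J$ of $A$). Denote by $(q_1,q_2,p_1,p_2,r_1,r_2)$ and $(w_1,w_2,w_3)$ the coordinates on $\mathbb R^6$ and $\mathbb R^3$, and put $\alpha^1=\omega^3_0$, $\alpha^2=\omega^2_1$. On $P$ consider the $1$-forms $\eta^1=\omega^4_0$, $\eta^2=\omega^2_0$, $\eta^3=\omega^3_1$, $\eta^4=\omega^3_2$, $\eta^5=\omega^1_0-\alpha^2$, $\eta^6=\omega^0_1-\alpha^1$, $\eta^7=\omega^0_2$, $\eta^8=\omega^1_3$, $\eta^9=\omega^0_0+2q_1\alpha^1-q_2\alpha^2$, $\eta^{10}=\omega^1_1+q_1\alpha^1-2q_2\alpha^2$, $\eta^{11}=\omega^0_3-r_1\alpha^1-p_2\alpha^2$, $\eta^{12}=\omega^1_2-p_1\alpha^1-r_2\alpha^2$, $\eta^{13}=\omega^0_4+r_2\alpha^1-r_1\alpha^2$,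 $\eta^{14}=dw_1-2w_1(2q_1\alpha^1-q_2\alpha^2)-w_3\alpha^1$, $\eta^{15}=dw_2-2w_2(q_1\alpha^1-2q_2\alpha^2)+w_3\alpha^2$, $\eta^{16}=dw_3+2w_1(p_2-1)\alpha^2-2w_2(p_1-1)\alpha^1-3w_3(q_1\alpha^1-q_2\alpha^2)$. The differential system of a deformation is the exterior differential system $(\mathcal I,\alpha^1\wedge\alpha^2)$ on $P$, where $\mathcal I$ is the differential ideal generated by $\eta^1,\dots,\eta^{16}$ and $\alpha^1\wedge\alpha^2\ne0$ is the independence condition. Its integral manifolds are the $2$-dimensional immersed surfaces in $P$ on which all forms of $\mathcal I$ vanish and $\alpha^1\wedge\alpha^2\neq0$. Involution and the count of arbitrary functions are meant in the usual sense of Cartan's theory of exterior differential systems. *)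

theory Defs
  imports "HOL-Analysis.Analysis"
begin

section \<open>The group and the manifold \<open>P\<close>\<close>

definition bil :: "real^6 \<Rightarrow> real^6 \<Rightarrow> real" where
  "bil X Y = - (X$0 * Y$5 + X$5 * Y$0) - (X$1 * Y$4 + X$4 * Y$1) + X$2 * Y$2 + X$3 * Y$3"

definition isometries :: "(real^6^6) set" where
  "isometries = {A. \<forall>X Y. bil (A *v X) (A *v Y) = bil X Y}"

definition G :: "(real^6^6) set" where
  "G = connected_component_set isometries (mat 1)"

definition lie_alg :: "(real^6^6) set" where
  "lie_alg = {X. \<forall>Y Z. bil (X *v Y) Z + bil Y (X *v Z) = 0}"

definition mexp :: "real^6^6 \<Rightarrow> real^6^6" where
  "mexp X = (\<Sum>n. (((\<lambda>B. X ** B) ^^ n) (mat 1)) /\<^sub>R fact n)"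

text \<open>
  A point of \<open>P\<close> is a triple \<open>({A, -A}, u, w)\<close> with
  \<open>u = (q1, q2, p1, p2, r1, r2)\<close> and \<open>w = (w1, w2, w3)\<close>. Components of \<open>u\<close> and \<open>w\<close> are
  numbered from 1; in the index type \<open>6\<close> the numeral \<open>6\<close> denotes \<open>0\<close>, in the index type \<open>3\<close>
  the numeral \<open>3\<close> denotes \<open>0\<close>. Rows and columns of matrices are numbered \<open>0, \<dots>, 5\<close>.
\<close>

type_synonym pt = "(real^6^6) set \<times> (real^6) \<times> (real^3)"
type_synonym tvec = "(real^6^6) \<times> (real^6) \<times> (real^3)"
type_synonym form = "pt \<Rightarrow> tvec list \<Rightarrow> real"

definition proj :: "tvec \<Rightarrow> pt" where
  "proj a = (case a of (A, u, w) \<Rightarrow> ({A, - A}, u, w))"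

definition P :: "pt set" where
  "P = proj ` (G \<times> UNIV \<times> UNIV)"

text \<open>The quotient topology.\<close>

definition P_top :: "pt topology" where
  "P_top = topology (\<lambda>U. U \<subseteq> P \<and>
     openin (top_of_set (G \<times> UNIV \<times> UNIV)) {a \<in> G \<times> UNIV \<times> UNIV. proj a \<in> U})"

text \<open>
  Every tangent space of \<open>P\<close> is identified with \<open>TP\<close>: the element \<open>(X, a, b)\<close> of \<open>TP\<close>, read
  at the class of \<open>(A, u, w)\<close>, is the tangent vector \<open>(A X, a, b)\<close>. Since
  \<open>(-A)\<^sup>-\<^sup>1 (-A X) = A\<^sup>-\<^sup>1 (A X) = X\<close>, this is independent of the representative, and the
  Maurer-Cartan form \<open>A\<^sup>-\<^sup>1 dA\<close> is the projection to \<open>X\<close>. A fixed element of \<open>TP\<close> is a vector field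
  on \<open>P\<close>, left-invariant on \<open>G\<close> and constant in the other factors, whose flow is \<open>flow\<close>.
\<close>

definition TP :: "tvec set" where
  "TP = lie_alg \<times> UNIV \<times> UNIV"

definition flow :: "tvec \<Rightarrow> real \<Rightarrow> pt \<Rightarrow> pt" where
  "flow v t x = (case v of (X, a, b) \<Rightarrow> case x of (C, u, w) \<Rightarrow>
     ((\<lambda>A. A ** mexp (t *\<^sub>R X)) ` C, u + t *\<^sub>R a, w + t *\<^sub>R b))"

definition mpow :: "real^6^6 \<Rightarrow> nat \<Rightarrow> real^6^6" where
  "mpow X n = ((\<lambda>B. X ** B) ^^ n) (mat 1)"

lemma mpow_simps: "mpow X 0 = mat 1" "mpow X (Suc n) = X ** mpow X n"
  by (auto simp: mpow_def)

lemma mpow_scale: "mpow (t *\<^sub>R X) n = t ^ n *\<^sub>R mpow X n"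
  by (induction n) (simp_all add: mpow_simps scalar_matrix_assoc matrix_scalar_ac scaleR_matrix_vector_assoc mult.commute)

lemma mpow_bound: "\<exists>M\<ge>0. \<forall>n i j. \<bar>mpow X n $ i $ j\<bar> \<le> M ^ n"
proof -
  define K where "K = (\<Sum>i\<in>UNIV. \<Sum>j\<in>UNIV. \<bar>X $ i $ j\<bar>)"
  have row: "(\<Sum>k\<in>UNIV. \<bar>X $ i $ k\<bar>) \<le> K" for i
    unfolding K_def by (rule member_le_sum[of i UNIV "\<lambda>i. \<Sum>j\<in>UNIV. \<bar>X $ i $ j\<bar>"]) (auto intro: sum_nonneg)
  have K0: "0 \<le> K" unfolding K_def by (auto intro!: sum_nonneg)
  have "\<bar>mpow X n $ i $ j\<bar> \<le> K ^ n" for n i j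
  proof (induction n arbitrary: i j)
    case 0 then show ?case by (simp add: mpow_simps mat_def)
  next
    case (Suc n)
    have "\<bar>mpow X (Suc n) $ i $ j\<bar> \<le> (\<Sum>k\<in>UNIV. \<bar>X $ i $ k\<bar> * \<bar>mpow X n $ k $ j\<bar>)"
      unfolding mpow_simps matrix_matrix_mult_def
      by (simp add: abs_mult[symmetric] sum_abs)
    also have "\<dots> \<le> (\<Sum>k\<in>UNIV. \<bar>X $ i $ k\<bar> * K ^ n)"
      by (intro sum_mono mult_left_mono Suc) auto
    also have "\<dots> \<le> K * K ^ n"
      unfolding sum_distrib_right[symmetric] by (intro mult_right_mono row) (simp add: K0)
    finally show ?case by simp
  qed
  with K0 show ?thesis by blast
qed

lemma entry_summable: "summable (\<lambda>n. (mpow X n $ i $ j / fact n) * t ^ n)"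
proof -
  obtain M where M: "M \<ge> 0" "\<And>n i j. \<bar>mpow X n $ i $ j\<bar> \<le> M ^ n" using mpow_bound by metis
  have s: "summable (\<lambda>n. inverse (fact n) * (M * \<bar>t\<bar>) ^ n)"
    using summable_exp by blast
  show ?thesis
  proof (rule summable_comparison_test'[OF s])
    fix n :: nat
    show "norm ((mpow X n $ i $ j / fact n) * t ^ n) \<le> inverse (fact n) * (M * \<bar>t\<bar>) ^ n"
      using mult_right_mono[OF M(2)[of n i j], of "\<bar>t\<bar> ^ n / fact n"]
      by (simp add: abs_mult power_abs power_mult_distrib field_simps)
  qed
qed

lemma mexp_entry: "mexp (t *\<^sub>R X) $ i $ j = (\<Sum>n. (mpow X n $ i $ j / fact n) * t ^ n)"
proof -
  let ?f = "\<lambda>n. mpow (t *\<^sub>R X) n /\<^sub>R fact n"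
  let ?S = "\<chi> i j. (\<Sum>n. (mpow X n $ i $ j / fact n) * t ^ n)"
  have "?f sums ?S"
    unfolding sums_def
  proof (intro vec_tendstoI)
    fix i j
    show "(\<lambda>n. sum ?f {..<n} $ i $ j) \<longlonglongrightarrow> ?S $ i $ j"
      using summable_sums[OF entry_summable[of X i j t]]
      by (simp add: sums_def mpow_scale field_simps)
  qed
  then show ?thesis
    unfolding mexp_def mpow_def[symmetric] by (simp add: sums_unique[symmetric])
qed

text \<open>The curve \<open>flow v t\<close> starts at the class of \<open>A\<close> with velocity \<open>A X\<close>, and \<open>A\<^sup>-\<^sup>1 (A X) = X\<close>.\<close>

lemma flow_velocity: "((\<lambda>t. A ** mexp (t *\<^sub>R X)) has_vector_derivative A ** X) (at 0)"
proof -
  have e: "((\<lambda>t. mexp (t *\<^sub>R X) $ i $ j) has_real_derivative X $ i $ j) (at 0)" for i j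
  proof -
    have "((\<lambda>t. \<Sum>n. (mpow X n $ i $ j / fact n) * t ^ n) has_real_derivative
        (\<Sum>n. diffs (\<lambda>n. mpow X n $ i $ j / fact n) n * 0 ^ n)) (at 0)"
      by (rule termdiffs_strong_converges_everywhere[OF entry_summable])
    then show ?thesis
      unfolding mexp_entry powser_zero by (simp add: diffs_def mpow_simps)
  qed
  have "((\<lambda>t. (A ** mexp (t *\<^sub>R X)) $ i $ j) has_real_derivative (A ** X) $ i $ j) (at 0)" for i j
    unfolding matrix_matrix_mult_def by (auto intro!: derivative_eq_intros e simp: mult.commute)
  then show ?thesis
    unfolding has_vector_derivative_def has_field_derivative_def
    by (subst has_derivative_componentwise_within)
       (auto simp: Basis_vec_def inner_axis mult_commute_abs)
qed
lemma exhaust_6':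
  fixes i :: 6
  obtains "i = 0" | "i = 1" | "i = 2" | "i = 3" | "i = 4" | "i = 5"
proof (cases i)
  case (of_int z)
  then have "z = 0 \<or> z = 1 \<or> z = 2 \<or> z = 3 \<or> z = 4 \<or> z = 5" by fastforce
  with of_int that show ?thesis by auto
qed

lemma isometry_invertible:
  assumes "A \<in> isometries"
  shows "invertible A"
proof -
  have "x = 0" if "A *v x = 0" for x
  proof -
    have "bil x Y = bil (A *v x) (A *v Y)" for Y
      using assms by (simp add: isometries_def)
    then have z: "bil x Y = 0" for Y
      using that by (simp add: bil_def)
    have "x $ i = 0" for i :: 6
      using z[of "axis 0 1"] z[of "axis 1 1"] z[of "axis 2 1"] z[of "axis 3 1"]
        z[of "axis 4 1"] z[of "axis 5 1"]
      by (cases i rule: exhaust_6') (simp_all add: bil_def axis_def)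
    then show ?thesis by (simp add: vec_eq_iff)
  qed
  then show ?thesis
    by (metis invertible_left_inverse matrix_left_invertible_ker)
qed

lemma maurer_cartan_value:
  assumes "A \<in> G"
  shows "matrix_inv A ** (A ** X) = X"
proof -
  have "A \<in> isometries"
    using assms connected_component_subset by (auto simp: G_def)
  then show ?thesis
    using isometry_invertible[of A] someI_ex[of "\<lambda>A'. A ** A' = mat 1 \<and> A' ** A = mat 1"]
    by (simp add: matrix_mul_assoc invertible_def matrix_inv_def)
qed

definition Lder :: "tvec \<Rightarrow> (pt \<Rightarrow> real) \<Rightarrow> pt \<Rightarrow> real" where
  "Lder v f x = deriv (\<lambda>t. f (flow v t x)) 0"

definition bracket :: "tvec \<Rightarrow> tvec \<Rightarrow> tvec" where
  "bracket v v' = (fst v ** fst v' - fst v' ** fst v, 0, 0)"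

section \<open>Differential forms on \<open>P\<close>\<close>

text \<open>
  The vector fields in \<open>TP\<close> frame the tangent bundle, so a function is smooth iff its iterated
  derivatives along them exist and are continuous. The value of a form of degree \<open>p\<close> is only
  meaningful at points of \<open>P\<close> and lists of \<open>p\<close> elements of \<open>TP\<close>.
\<close>

primrec Ck :: "nat \<Rightarrow> (pt \<Rightarrow> real) \<Rightarrow> bool" where
  "Ck 0 f = continuous_map P_top euclidean f"
| "Ck (Suc k) f = (continuous_map P_top euclidean f \<and>
     (\<forall>v\<in>TP. (\<forall>x\<in>P. (\<lambda>t. f (flow v t x)) differentiable (at 0)) \<and> Ck k (Lder v f)))"

definition smooth :: "(pt \<Rightarrow> real) \<Rightarrow> bool" where
  "smooth f \<longleftrightarrow> (\<forall>k. Ck k f)"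

definition smooth_form :: "nat \<Rightarrow> form \<Rightarrow> bool" where
  "smooth_form p \<phi> \<longleftrightarrow>
     (\<forall>vs. length vs = p \<and> set vs \<subseteq> TP \<longrightarrow>
        smooth (\<lambda>x. \<phi> x vs) \<and>
        (\<forall>x\<in>P.
          (\<forall>i<p. \<forall>v\<in>TP. \<forall>v'\<in>TP. \<forall>c c'.
             \<phi> x (vs[i := c *\<^sub>R v + c' *\<^sub>R v']) = c * \<phi> x (vs[i := v]) + c' * \<phi> x (vs[i := v'])) \<and>
          (\<forall>i<p. \<forall>j<p. i \<noteq> j \<and> vs ! i = vs ! j \<longrightarrow> \<phi> x vs = 0)))"

definition wedge :: "nat \<Rightarrow> nat \<Rightarrow> form \<Rightarrow> form \<Rightarrow> form" where
  "wedge p q \<phi> \<psi> x vs =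
     (\<Sum>\<sigma> | \<sigma> permutes {..<p + q}. of_int (sign \<sigma>) *
        \<phi> x (map (\<lambda>i. vs ! \<sigma> i) [0..<p]) * \<psi> x (map (\<lambda>i. vs ! \<sigma> i) [p..<p + q]))
     / (fact p * fact q)"

definition omit :: "nat \<Rightarrow> 'a list \<Rightarrow> 'a list" where
  "omit i vs = take i vs @ drop (Suc i) vs"

text \<open>
  Exterior derivative of a form of degree \<open>p\<close>, by the invariant formula on the vector fields in
  \<open>TP\<close>; the Lie bracket of these fields is \<open>bracket\<close>.
\<close>

definition ext_d :: "nat \<Rightarrow> form \<Rightarrow> form" where
  "ext_d p \<phi> x vs =
     (\<Sum>i\<le>p. (-1) ^ i * Lder (vs ! i) (\<lambda>y. \<phi> y (omit i vs)) x) +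
     (\<Sum>j\<le>p. \<Sum>i<j. (-1) ^ (i + j) * \<phi> x (bracket (vs ! i) (vs ! j) # omit i (omit j vs)))"

text \<open>The differential ideal generated by a set of forms, each paired with its degree.\<close>

inductive_set diff_ideal :: "(nat \<times> form) set \<Rightarrow> (nat \<times> form) set"
  for S :: "(nat \<times> form) set" where
  gen: "g \<in> S \<Longrightarrow> g \<in> diff_ideal S"
| add: "(p, \<phi>) \<in> diff_ideal S \<Longrightarrow> (p, \<psi>) \<in> diff_ideal S \<Longrightarrow>
    (p, \<lambda>x vs. \<phi> x vs + \<psi> x vs) \<in> diff_ideal S"
| mult: "smooth_form q \<psi> \<Longrightarrow> (p, \<phi>) \<in> diff_ideal S \<Longrightarrow> (q + p, wedge q p \<psi> \<phi>) \<in> diff_ideal S"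
| deriv: "(p, \<phi>) \<in> diff_ideal S \<Longrightarrow> (Suc p, ext_d p \<phi>) \<in> diff_ideal S"

section \<open>Cartan-Kaehler theory\<close>

text \<open>
  Terminology as in Bryant, Chern, Gardner, Goldschmidt, Griffiths, Exterior Differential Systems,
  Chapters III and IV. The argument \<open>I\<close> is a differential ideal. Forms of degree larger than
  \<open>p\<close> vanish on every \<open>p\<close>-dimensional space.
\<close>

definition integral_element :: "(nat \<times> form) set \<Rightarrow> nat \<Rightarrow> pt \<Rightarrow> tvec set \<Rightarrow> bool" where
  "integral_element I p x E \<longleftrightarrow> x \<in> P \<and> subspace E \<and> E \<subseteq> TP \<and> dim E = p \<and>
     (\<forall>q \<phi> vs. (q, \<phi>) \<in> I \<and> q \<le> p \<and> length vs = q \<and> set vs \<subseteq> E \<longrightarrow> \<phi> x vs = 0)"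

definition nonzero_on :: "nat \<Rightarrow> form \<Rightarrow> pt \<Rightarrow> tvec set \<Rightarrow> bool" where
  "nonzero_on n \<Omega> x E \<longleftrightarrow> (\<exists>vs. length vs = n \<and> set vs \<subseteq> E \<and> \<Omega> x vs \<noteq> 0)"

definition polar_space :: "(nat \<times> form) set \<Rightarrow> nat \<Rightarrow> pt \<Rightarrow> tvec set \<Rightarrow> tvec set" where
  "polar_space I p x E = {v \<in> TP. \<forall>\<phi> vs. (Suc p, \<phi>) \<in> I \<and> length vs = p \<and> set vs \<subseteq> E \<longrightarrow>
     \<phi> x (v # vs) = 0}"

text \<open>
  Conditions on \<open>p\<close>-planes near a given one are expressed through frames: \<open>R\<close> holds for all
  points \<open>y\<close> near \<open>x\<close> and all frames \<open>fs\<close> near \<open>es\<close>.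
\<close>

definition near_frame :: "pt \<Rightarrow> tvec list \<Rightarrow> (pt \<Rightarrow> tvec list \<Rightarrow> bool) \<Rightarrow> bool" where
  "near_frame x es R \<longleftrightarrow> (\<exists>U \<epsilon>. openin P_top U \<and> x \<in> U \<and> \<epsilon> > 0 \<and>
     (\<forall>y\<in>U. \<forall>fs. length fs = length es \<and> set fs \<subseteq> TP \<and>
        (\<forall>i<length es. dist (fs ! i) (es ! i) < \<epsilon>) \<longrightarrow> R y fs))"

text \<open>
  The differential at \<open>(x, es)\<close>, in the direction \<open>(v, fs)\<close>, of the function
  \<open>(y, gs) \<mapsto> \<phi> y gs\<close> on the bundle of frames.
\<close>

definition frame_differential :: "form \<Rightarrow> pt \<Rightarrow> tvec list \<Rightarrow> tvec \<Rightarrow> tvec list \<Rightarrow> real" where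
  "frame_differential \<phi> x es v fs =
     Lder v (\<lambda>y. \<phi> y es) x + (\<Sum>i<length es. \<phi> x (es[i := fs ! i]))"

text \<open>
  Kaehler-ordinary: near \<open>E\<close>, the integral elements of dimension \<open>p\<close> are the common zeros of finitely
  many functions, given by forms of degree \<open>p\<close> in the ideal, with independent differentials at
  \<open>E\<close>. The functions are taken on frames rather than on the Grassmann bundle; the map from
  frames to planes is a submersion, along which these functions change by a nonzero factor.
\<close>

definition kahler_ordinary :: "(nat \<times> form) set \<Rightarrow> nat \<Rightarrow> pt \<Rightarrow> tvec set \<Rightarrow> bool" where
  "kahler_ordinary I p x E \<longleftrightarrow> integral_element I p x E \<and>
     (\<exists>es F. length es = p \<and> span (set es) = E \<and> finite F \<and> (\<forall>\<phi>\<in>F. (p, \<phi>) \<in> I) \<and>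
        near_frame x es (\<lambda>y fs. integral_element I p y (span (set fs)) \<longleftrightarrow> (\<forall>\<phi>\<in>F. \<phi> y fs = 0)) \<and>
        (\<forall>c. (\<forall>v\<in>TP. \<forall>fs. length fs = p \<and> set fs \<subseteq> TP \<longrightarrow>
                 (\<Sum>\<phi>\<in>F. c \<phi> * frame_differential \<phi> x es v fs) = 0) \<longrightarrow> (\<forall>\<phi>\<in>F. c \<phi> = 0)))"

definition kahler_regular :: "(nat \<times> form) set \<Rightarrow> nat \<Rightarrow> pt \<Rightarrow> tvec set \<Rightarrow> bool" where
  "kahler_regular I p x E \<longleftrightarrow> kahler_ordinary I p x E \<and>
     (\<exists>es. length es = p \<and> span (set es) = E \<and>
        near_frame x es (\<lambda>y fs. integral_element I p y (span (set fs)) \<longrightarrow>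
          dim (polar_space I p y (span (set fs))) = dim (polar_space I p x E)))"

definition regular_flag :: "(nat \<times> form) set \<Rightarrow> nat \<Rightarrow> pt \<Rightarrow> (nat \<Rightarrow> tvec set) \<Rightarrow> bool" where
  "regular_flag I n x F \<longleftrightarrow>
     (\<forall>k\<le>n. integral_element I k x (F k)) \<and>
     (\<forall>k<n. F k \<subseteq> F (Suc k) \<and> kahler_regular I k x (F k))"

definition ordinary_element :: "(nat \<times> form) set \<Rightarrow> nat \<Rightarrow> pt \<Rightarrow> tvec set \<Rightarrow> bool" where
  "ordinary_element I n x E \<longleftrightarrow> (\<exists>F. regular_flag I n x F \<and> F n = E)"

definition polar_codim ::
  "(nat \<times> form) set \<Rightarrow> nat \<Rightarrow> pt \<Rightarrow> (nat \<Rightarrow> tvec set) \<Rightarrow> nat \<Rightarrow> int" where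
  "polar_codim I n x F k =
     (if k < n then int (dim TP) - int (dim (polar_space I k x (F k))) else int (dim TP) - int n)"

definition cartan_character ::
  "(nat \<times> form) set \<Rightarrow> nat \<Rightarrow> pt \<Rightarrow> (nat \<Rightarrow> tvec set) \<Rightarrow> nat \<Rightarrow> int" where
  "cartan_character I n x F k =
     polar_codim I n x F k - (if k = 0 then 0 else polar_codim I n x F (k - 1))"

definition in_involution_at :: "(nat \<times> form) set \<Rightarrow> nat \<Rightarrow> form \<Rightarrow> pt \<Rightarrow> bool" where
  "in_involution_at I n \<Omega> x \<longleftrightarrow> (\<exists>E. ordinary_element I n x E \<and> nonzero_on n \<Omega> x E)"

text \<open>Involution is a property of the system at general points.\<close>

definition in_involution :: "(nat \<times> form) set \<Rightarrow> nat \<Rightarrow> form \<Rightarrow> bool" where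
  "in_involution I n \<Omega> \<longleftrightarrow> (\<exists>U. openin P_top U \<and> P_top closure_of U = P \<and>
     (\<forall>x\<in>U. in_involution_at I n \<Omega> x))"

text \<open>
  The general integral manifolds, i.e. those tangent to ordinary integral elements, depend on
  \<open>s\<close> functions of \<open>k\<close> variables: the last nonvanishing Cartan character is the \<open>k\<close>-th one,
  and it equals \<open>s\<close>.
\<close>

definition general_integrals_depend_on ::
  "(nat \<times> form) set \<Rightarrow> nat \<Rightarrow> form \<Rightarrow> nat \<Rightarrow> nat \<Rightarrow> bool" where
  "general_integrals_depend_on I n \<Omega> s k \<longleftrightarrow> s \<noteq> 0 \<and> k \<le> n \<and>
     (\<forall>x\<in>P. \<forall>F. regular_flag I n x F \<and> nonzero_on n \<Omega> x (F n) \<longrightarrow>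
        cartan_character I n x F k = int s \<and> (\<forall>j\<in>{k<..n}. cartan_character I n x F j = 0))"

section \<open>The differential system of a deformation\<close>

definition q1 :: "pt \<Rightarrow> real" where "q1 x = fst (snd x) $ 1"
definition q2 :: "pt \<Rightarrow> real" where "q2 x = fst (snd x) $ 2"
definition p1 :: "pt \<Rightarrow> real" where "p1 x = fst (snd x) $ 3"
definition p2 :: "pt \<Rightarrow> real" where "p2 x = fst (snd x) $ 4"
definition r1 :: "pt \<Rightarrow> real" where "r1 x = fst (snd x) $ 5"
definition r2 :: "pt \<Rightarrow> real" where "r2 x = fst (snd x) $ 6"
definition w1 :: "pt \<Rightarrow> real" where "w1 x = snd (snd x) $ 1"
definition w2 :: "pt \<Rightarrow> real" where "w2 x = snd (snd x) $ 2"
definition w3 :: "pt \<Rightarrow> real" where "w3 x = snd (snd x) $ 3"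

text \<open>\<open>\<omega> I J\<close> is the entry in row \<open>I\<close> (upper index) and column \<open>J\<close> (lower index).\<close>

definition \<omega> :: "6 \<Rightarrow> 6 \<Rightarrow> form" where
  "\<omega> I J x vs = fst (vs ! 0) $ I $ J"

text \<open>The structure equations \<open>d\<omega> = - \<omega> \<and> \<omega>\<close>.\<close>

lemma structure_equations:
  "ext_d 1 (\<omega> I J) x [v, v'] = - (\<Sum>K\<in>UNIV. wedge 1 1 (\<omega> I K) (\<omega> K J) x [v, v'])"
proof -
  have p: "{\<sigma>. \<sigma> permutes {..<Suc (Suc 0)}} = {id, Transposition.transpose 0 (Suc 0)}"
    using permutes_doubleton_iff[of _ 0 "Suc 0"] by (auto simp: lessThan_Suc insert_commute)
  have ne: "id \<noteq> Transposition.transpose 0 (Suc 0)"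
    by (metis id_apply n_not_Suc_n transpose_apply_first)
  have c: "Lder v (\<lambda>y. c) x = 0" for v c
    by (simp add: Lder_def)
  have w: "wedge 1 1 (\<omega> I K) (\<omega> K J) x [v, v']
      = fst v $ I $ K * fst v' $ K $ J - fst v' $ I $ K * fst v $ K $ J" for K
    using ne by (simp add: wedge_def p sign_swap_id \<omega>_def)
  have "ext_d 1 (\<omega> I J) x [v, v'] = - (fst v ** fst v' - fst v' ** fst v) $ I $ J"
    by (simp add: ext_d_def \<omega>_def c bracket_def omit_def)
  then show ?thesis
    unfolding w by (simp add: matrix_matrix_mult_def sum_subtractf)
qed

definition d0 :: "(pt \<Rightarrow> real) \<Rightarrow> form" where
  "d0 f = ext_d 0 (\<lambda>x vs. f x)"

definition \<alpha>1 :: form where "\<alpha>1 = \<omega> 3 0"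
definition \<alpha>2 :: form where "\<alpha>2 = \<omega> 2 1"

definition etas :: "form list" where
  "etas = [
     \<omega> 4 0,
     \<omega> 2 0,
     \<omega> 3 1,
     \<omega> 3 2,
     (\<lambda>x v. \<omega> 1 0 x v - \<alpha>2 x v),
     (\<lambda>x v. \<omega> 0 1 x v - \<alpha>1 x v),
     \<omega> 0 2,
     \<omega> 1 3,
     (\<lambda>x v. \<omega> 0 0 x v + 2 * q1 x * \<alpha>1 x v - q2 x * \<alpha>2 x v),
     (\<lambda>x v. \<omega> 1 1 x v + q1 x * \<alpha>1 x v - 2 * q2 x * \<alpha>2 x v),
     (\<lambda>x v. \<omega> 0 3 x v - r1 x * \<alpha>1 x v - p2 x * \<alpha>2 x v),
     (\<lambda>x v. \<omega> 1 2 x v - p1 x * \<alpha>1 x v - r2 x * \<alpha>2 x v),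
     (\<lambda>x v. \<omega> 0 4 x v + r2 x * \<alpha>1 x v - r1 x * \<alpha>2 x v),
     (\<lambda>x v. d0 w1 x v - 2 * w1 x * (2 * q1 x * \<alpha>1 x v - q2 x * \<alpha>2 x v) - w3 x * \<alpha>1 x v),
     (\<lambda>x v. d0 w2 x v - 2 * w2 x * (q1 x * \<alpha>1 x v - 2 * q2 x * \<alpha>2 x v) + w3 x * \<alpha>2 x v),
     (\<lambda>x v. d0 w3 x v + 2 * w1 x * (p2 x - 1) * \<alpha>2 x v - 2 * w2 x * (p1 x - 1) * \<alpha>1 x v
              - 3 * w3 x * (q1 x * \<alpha>1 x v - q2 x * \<alpha>2 x v))]"

definition deformation_ideal :: "(nat \<times> form) set" where
  "deformation_ideal = diff_ideal ((\<lambda>\<eta>. (1, \<eta>)) ` set etas)"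

definition independence_form :: form where
  "independence_form = wedge 1 1 \<alpha>1 \<alpha>2"

end

theory Submission
  imports Defs
begin

text \<open>
Everything happens inside the common kernel \<open>eta_ker x\<close> of the sixteen forms \<open>\<eta>\<close>, an
8-dimensional subspace of the 24-dimensional tangent space on which \<open>\<alpha>1\<close>, \<open>\<alpha>2\<close> and the six
differentials \<open>du\<close> are coordinates. By the structure equations the derivatives of the first
eight forms vanish there, and two of the others are multiples of earlier ones:
\<open>d\<eta>\<^sup>1\<^sup>4 = -2 w1 d\<eta>\<^sup>9\<close> and \<open>d\<eta>\<^sup>1\<^sup>5 = -2 w2 d\<eta>\<^sup>1\<^sup>0\<close>. What remains are six 2-forms
(\<open>reduced_d_eta\<close>), each a combination of the \<open>du \<and> \<alpha>\<close> plus a multiple of \<open>\<alpha>1 \<and> \<alpha>2\<close>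
(\<open>d_etas_hor\<close>). A form of degree 1 in the ideal is a combination of the \<open>\<eta>\<close>, and a form of
degree 2 in the ideal vanishes on two vectors of \<open>eta_ker x\<close> as soon as these six 2-forms do
(\<open>deformation_ideal_low_degree\<close>). Since the ideal also contains the \<open>\<eta>\<close>, the \<open>d\<eta>\<close> and the \<open>\<alpha>1 \<and> \<eta>\<close>,
these conditions determine its polar spaces.

So the polar space of the zero element is \<open>eta_ker x\<close>, of codimension 16, and the polar space of
a line spanned by \<open>e\<close> consists of the \<open>v\<close> in \<open>eta_ker x\<close> with \<open>reduced_d_eta x v e = 0\<close>. In the six
directions \<open>\<alpha>1 = \<alpha>2 = 0\<close> this is a square linear system. It is nonsingular iff the characteristic
form \<open>a b (w2 b\<^sup>2 - w1 a\<^sup>2)\<close> is nonzero at \<open>(a, b) = (\<alpha>1 e, \<alpha>2 e)\<close>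
(\<open>reduced_d_eta_vertical_injective\<close>). Then the terms in \<open>\<alpha>1 \<and> \<alpha>2\<close> can be absorbed, the polar
space is a plane projecting isomorphically to \<open>(\<alpha>1, \<alpha>2)\<close>, and this plane is itself an integral
element (\<open>char_plane_isotropic\<close>). The codimensions of the polar spaces are 16, 22, 22 and the
Cartan characters 16, 6, 0.

For involution it suffices to have one such line over a dense open set of points: where
\<open>w1 \<noteq> w2\<close>, the line with \<open>\<alpha>1 = \<alpha>2\<close> will do. For the count of functions the characters are needed
for every regular flag, including lines and points where the characteristic form vanishes. But
regularity makes the dimension of the polar space locally constant, and every line is a limit
of non-characteristic ones at nearby points (\<open>generic_dense\<close>), so that dimension is always 2.
\<close>

section \<open>The Lie algebra\<close>

definition vec6 :: "'a \<Rightarrow> 'a \<Rightarrow> 'a \<Rightarrow> 'a \<Rightarrow> 'a \<Rightarrow> 'a \<Rightarrow> 'a^6" where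
  "vec6 a b c d e f = (\<chi> i. if i = 0 then a else if i = 1 then b else if i = 2 then c
     else if i = 3 then d else if i = 4 then e else f)"

lemma six_zero: "(6::6) = 0"
  by simp

lemma vec6_nth [simp]:
  "vec6 a b c d e f $ 0 = a" "vec6 a b c d e f $ 1 = b" "vec6 a b c d e f $ 2 = c"
  "vec6 a b c d e f $ 3 = d" "vec6 a b c d e f $ 4 = e" "vec6 a b c d e f $ 5 = f"
  by (simp_all add: vec6_def)

lemma all_6: "(\<forall>i::6. Q i) \<longleftrightarrow> Q 0 \<and> Q 1 \<and> Q 2 \<and> Q 3 \<and> Q 4 \<and> Q 5"
  by (metis exhaust_6')

lemma sum_6: "(\<Sum>i\<in>(UNIV::6 set). g i) = g 0 + g 1 + g 2 + g 3 + g 4 + (g 5 :: real)"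
proof -
  have "(UNIV::6 set) = {0,1,2,3,4,5}"
    using exhaust_6' by blast
  then have "sum g UNIV = sum g {0,1,2,3,4,5}" by (rule arg_cong)
  then show ?thesis by (simp add: add.assoc)
qed

lemma eq_vec6: "X = vec6 a b c d e f \<longleftrightarrow>
    X $ 0 = a \<and> X $ 1 = b \<and> X $ 2 = c \<and> X $ 3 = d \<and> X $ 4 = e \<and> X $ 5 = f"
  by (simp add: vec_eq_iff all_6)

text \<open>
An element of the Lie algebra in terms of fifteen of its entries: the Gram matrix of \<open>bil\<close> times the
element is skew-symmetric, and this determines the other entries.
\<close>

definition lie_mat :: "real \<Rightarrow> real \<Rightarrow> real \<Rightarrow> real \<Rightarrow> real \<Rightarrow> real \<Rightarrow> real \<Rightarrow> real \<Rightarrow> real \<Rightarrow> real \<Rightarrow>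
    real \<Rightarrow> real \<Rightarrow> real \<Rightarrow> real \<Rightarrow> real \<Rightarrow> real^6^6" where
  "lie_mat x00 x01 x02 x03 x04 x10 x11 x12 x13 x20 x21 x30 x31 x32 x40 = vec6
     (vec6 x00 x01 x02 x03 x04 0)
     (vec6 x10 x11 x12 x13 0 (- x04))
     (vec6 x20 x21 0 (- x32) x12 x02)
     (vec6 x30 x31 x32 0 x13 x03)
     (vec6 x40 0 x21 x31 (- x11) (- x01))
     (vec6 0 (- x40) x20 x30 (- x10) (- x00))"

lemma lie_mat_in_lie_alg:
  "lie_mat x00 x01 x02 x03 x04 x10 x11 x12 x13 x20 x21 x30 x31 x32 x40 \<in> lie_alg"
  by (simp add: lie_alg_def bil_def lie_mat_def matrix_vector_mult_def sum_6 algebra_simps)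

lemma lie_alg_eq_lie_mat:
  assumes "X \<in> lie_alg"
  shows "X = lie_mat (X$0$0) (X$0$1) (X$0$2) (X$0$3) (X$0$4) (X$1$0) (X$1$1) (X$1$2) (X$1$3)
    (X$2$0) (X$2$1) (X$3$0) (X$3$1) (X$3$2) (X$4$0)"
proof -
  have col: "(X *v axis j 1) $ i = X $ i $ j" for i j
    by (simp add: matrix_vector_mult_basis column_def)
  have b: "bil (X *v axis i 1) (axis j 1) + bil (axis i 1) (X *v axis j 1) = 0" for i j
    using assms by (simp add: lie_alg_def)
  note r = b[unfolded bil_def col]
  show ?thesis
    using r[of 0 0] r[of 0 1] r[of 0 2] r[of 0 3] r[of 0 4] r[of 0 5] r[of 1 1] r[of 1 2]
      r[of 1 3] r[of 1 4] r[of 1 5] r[of 2 2] r[of 2 3] r[of 2 4] r[of 2 5] r[of 3 3] r[of 3 4]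
      r[of 3 5] r[of 4 4] r[of 4 5] r[of 5 5]
    by (simp add: lie_mat_def eq_vec6 axis_def)
qed

lemma dim_lie_alg: "dim lie_alg = 15"
proof -
  define L :: "(real^6) \<times> (real^6) \<times> (real^3) \<Rightarrow> real^6^6" where
    "L = (\<lambda>(a, b, c). lie_mat (a$0) (a$1) (a$2) (a$3) (a$4) (a$5) (b$0) (b$1) (b$2) (b$3) (b$4) (b$5)
       (c$1) (c$2) (c$3))"
  have lin: "linear L"
    by (rule linearI) (auto simp: L_def lie_mat_def vec_eq_iff all_6)
  have inj: "inj L"
    unfolding linear_injective_0[OF lin]
    by (auto simp: L_def lie_mat_def vec_eq_iff all_6 forall_3 zero_prod_def)
  have "range L = lie_alg"
  proof
    show "range L \<subseteq> lie_alg"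
      by (auto simp: L_def lie_mat_in_lie_alg)
    show "lie_alg \<subseteq> range L"
    proof
      fix X assume "X \<in> lie_alg"
      then have "X = L (vec6 (X$0$0) (X$0$1) (X$0$2) (X$0$3) (X$0$4) (X$1$0),
          vec6 (X$1$1) (X$1$2) (X$1$3) (X$2$0) (X$2$1) (X$3$0),
          vector [X$3$1, X$3$2, X$4$0])"
        using lie_alg_eq_lie_mat[of X] by (simp add: L_def vector_3)
      then show "X \<in> range L" by blast
    qed
  qed
  moreover have "dim (range L) = dim (UNIV :: ((real^6) \<times> (real^6) \<times> (real^3)) set)"
    by (rule dim_image_eq[OF lin]) (use inj in \<open>auto simp: inj_on_def\<close>)
  ultimately show ?thesis by simp
qed

lemma subspace_lie_alg: "subspace lie_alg"
proof (rule subspaceI)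
  have bil_lin: "bil (X + X') Y = bil X Y + bil X' Y" "bil Y (X + X') = bil Y X + bil Y X'"
    "bil (c *\<^sub>R X) Y = c * bil X Y" "bil Y (c *\<^sub>R X) = c * bil Y X" for X X' Y c
    by (simp_all add: bil_def algebra_simps)
  show "0 \<in> lie_alg"
    by (simp add: lie_alg_def bil_def)
  show "X + X' \<in> lie_alg" if "X \<in> lie_alg" "X' \<in> lie_alg" for X X'
    unfolding lie_alg_def
  proof (intro CollectI allI)
    fix Y Z
    have "bil (X *v Y) Z + bil Y (X *v Z) = 0" "bil (X' *v Y) Z + bil Y (X' *v Z) = 0"
      using that by (simp_all add: lie_alg_def)
    then show "bil ((X + X') *v Y) Z + bil Y ((X + X') *v Z) = 0"
      by (simp add: matrix_vector_mult_add_rdistrib bil_lin)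
  qed
  show "c *\<^sub>R X \<in> lie_alg" if "X \<in> lie_alg" for c X
    unfolding lie_alg_def
  proof (intro CollectI allI)
    fix Y Z
    have "bil (X *v Y) Z + bil Y (X *v Z) = 0"
      using that by (simp add: lie_alg_def)
    then show "bil ((c *\<^sub>R X) *v Y) Z + bil Y ((c *\<^sub>R X) *v Z) = 0"
      by (simp add: scaleR_matrix_vector_assoc[symmetric] bil_lin distrib_left[symmetric])
  qed
qed

lemma subspace_TP: "subspace TP"
  unfolding TP_def by (intro subspace_Times subspace_lie_alg subspace_UNIV)

lemma dim_TP: "dim TP = 24"
  unfolding TP_def by (simp add: dim_Times subspace_Times subspace_lie_alg dim_lie_alg)

section \<open>The common kernel of the sixteen forms\<close>

definition al1 :: "tvec \<Rightarrow> real" where "al1 v = fst v $ 3 $ 0"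
definition al2 :: "tvec \<Rightarrow> real" where "al2 v = fst v $ 2 $ 1"
definition du :: "6 \<Rightarrow> tvec \<Rightarrow> real" where "du i v = fst (snd v) $ i"
definition dw :: "3 \<Rightarrow> tvec \<Rightarrow> real" where "dw i v = snd (snd v) $ i"

lemma alpha_eq: "\<alpha>1 x (v # vs) = al1 v" "\<alpha>2 x (v # vs) = al2 v"
  by (simp_all add: \<alpha>1_def \<alpha>2_def \<omega>_def al1_def al2_def)

lemma coordinates_flow:
  "q1 (flow v t x) = q1 x + t * du 1 v" "q2 (flow v t x) = q2 x + t * du 2 v"
  "p1 (flow v t x) = p1 x + t * du 3 v" "p2 (flow v t x) = p2 x + t * du 4 v"
  "r1 (flow v t x) = r1 x + t * du 5 v" "r2 (flow v t x) = r2 x + t * du 6 v"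
  "w1 (flow v t x) = w1 x + t * dw 1 v" "w2 (flow v t x) = w2 x + t * dw 2 v"
  "w3 (flow v t x) = w3 x + t * dw 3 v"
  by (simp_all add: q1_def q2_def p1_def p2_def r1_def r2_def w1_def w2_def w3_def flow_def du_def
      dw_def split: prod.split)

lemma Lder_eqI:
  assumes "((\<lambda>t. f (flow v t x)) has_real_derivative D) (at 0)"
  shows "Lder v f x = D"
  unfolding Lder_def by (rule DERIV_imp_deriv[OF assms])

lemma d0_eq_Lder: "d0 f x [v] = Lder v f x"
  by (simp add: d0_def ext_d_def omit_def)

lemma d0_w:
  "d0 w1 x [v] = dw 1 v" "d0 w2 x [v] = dw 2 v" "d0 w3 x [v] = dw 3 v"
  unfolding d0_eq_Lder
  by (rule Lder_eqI; simp only: coordinates_flow; auto intro!: derivative_eq_intros)+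

lemma length_etas: "length etas = 16"
  by (simp add: etas_def)

lemma etas_eq:
  "(etas ! 0) x [v] = fst v $ 4 $ 0"
  "(etas ! 1) x [v] = fst v $ 2 $ 0"
  "(etas ! 2) x [v] = fst v $ 3 $ 1"
  "(etas ! 3) x [v] = fst v $ 3 $ 2"
  "(etas ! 4) x [v] = fst v $ 1 $ 0 - al2 v"
  "(etas ! 5) x [v] = fst v $ 0 $ 1 - al1 v"
  "(etas ! 6) x [v] = fst v $ 0 $ 2"
  "(etas ! 7) x [v] = fst v $ 1 $ 3"
  "(etas ! 8) x [v] = fst v $ 0 $ 0 + 2 * q1 x * al1 v - q2 x * al2 v"
  "(etas ! 9) x [v] = fst v $ 1 $ 1 + q1 x * al1 v - 2 * q2 x * al2 v"
  "(etas ! 10) x [v] = fst v $ 0 $ 3 - r1 x * al1 v - p2 x * al2 v"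
  "(etas ! 11) x [v] = fst v $ 1 $ 2 - p1 x * al1 v - r2 x * al2 v"
  "(etas ! 12) x [v] = fst v $ 0 $ 4 + r2 x * al1 v - r1 x * al2 v"
  "(etas ! 13) x [v] = dw 1 v - 2 * w1 x * (2 * q1 x * al1 v - q2 x * al2 v) - w3 x * al1 v"
  "(etas ! 14) x [v] = dw 2 v - 2 * w2 x * (q1 x * al1 v - 2 * q2 x * al2 v) + w3 x * al2 v"
  "(etas ! 15) x [v] = dw 3 v + 2 * w1 x * (p2 x - 1) * al2 v - 2 * w2 x * (p1 x - 1) * al1 v
     - 3 * w3 x * (q1 x * al1 v - q2 x * al2 v)"
  by (simp_all add: etas_def alpha_eq d0_w \<omega>_def)

lemma all_less_16: "(\<forall>k<16. Q k) \<longleftrightarrow> Q 0 \<and> Q 1 \<and> Q 2 \<and> Q 3 \<and> Q 4 \<and> Q 5 \<and> Q 6 \<and> Q 7 \<and>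
    Q 8 \<and> Q 9 \<and> Q 10 \<and> Q 11 \<and> Q 12 \<and> Q 13 \<and> Q 14 \<and> Q (15::nat)"
  by (simp add: numeral_eq_Suc All_less_Suc conj_ac)

text \<open>
The integral elements of dimension 1 are the lines in this space.
\<close>

definition eta_ker :: "pt \<Rightarrow> tvec set" where
  "eta_ker x = {v \<in> TP. \<forall>k<16. (etas ! k) x [v] = 0}"

text \<open>
The vector in the common kernel of the \<open>\<eta>\<close> at \<open>x\<close> with \<open>\<alpha>1 = a\<close>, \<open>\<alpha>2 = b\<close> and \<open>du = d\<close>, obtained
by solving the sixteen equations for the remaining entries of \<open>\<omega>\<close> and for \<open>dw\<close>.
\<close>

definition hor :: "pt \<Rightarrow> real \<Rightarrow> real \<Rightarrow> real^6 \<Rightarrow> tvec" where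
  "hor x a b d = (lie_mat (q2 x * b - 2 * q1 x * a) a 0 (r1 x * a + p2 x * b) (r1 x * b - r2 x * a)
       b (2 * q2 x * b - q1 x * a) (p1 x * a + r2 x * b) 0 0 b a 0 0 0, d,
     vector [2 * w1 x * (2 * q1 x * a - q2 x * b) + w3 x * a,
       2 * w2 x * (q1 x * a - 2 * q2 x * b) - w3 x * b,
       2 * w2 x * (p1 x - 1) * a - 2 * w1 x * (p2 x - 1) * b + 3 * w3 x * (q1 x * a - q2 x * b)])"

lemma hor_coordinates: "al1 (hor x a b d) = a" "al2 (hor x a b d) = b" "fst (snd (hor x a b d)) = d"
    "du i (hor x a b d) = d $ i"
  by (simp_all add: hor_def al1_def al2_def du_def lie_mat_def)

lemma hor_in_eta_ker: "hor x a b d \<in> eta_ker x"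
  unfolding eta_ker_def all_less_16 etas_eq hor_coordinates
  by (simp add: TP_def hor_def lie_mat_in_lie_alg dw_def vector_3)
     (simp add: lie_mat_def al1_def al2_def algebra_simps)

lemma eta_ker_eq_hor:
  assumes "v \<in> eta_ker x"
  shows "v = hor x (al1 v) (al2 v) (fst (snd v))"
proof -
  obtain X d b where v: "v = (X, d, b)" by (cases v)
  have X: "X \<in> lie_alg"
    using assms by (simp add: eta_ker_def TP_def v)
  show ?thesis
    using assms unfolding v hor_def eta_ker_def all_less_16 mem_Collect_eq etas_eq
    by (subst lie_alg_eq_lie_mat[OF X])
       (simp add: al1_def al2_def dw_def lie_mat_def vec_eq_iff all_6 forall_3 vector_3 algebra_simps)
qed

lemma etas_linear:
  assumes "k < 16"
  shows "(etas ! k) x [c *\<^sub>R v + v'] = c * (etas ! k) x [v] + (etas ! k) x [v']"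
proof -
  have "\<forall>k<16. (etas ! k) x [c *\<^sub>R v + v'] = c * (etas ! k) x [v] + (etas ! k) x [v']"
    unfolding all_less_16 etas_eq al1_def al2_def dw_def by (simp add: algebra_simps)
  then show ?thesis using assms by simp
qed

lemma subspace_eta_ker: "subspace (eta_ker x)"
proof (rule subspaceI)
  have z: "(etas ! k) x [0] = 0" if "k < 16" for k
    using etas_linear[OF that, of x 1 0 0] by simp
  then show "0 \<in> eta_ker x"
    by (simp add: eta_ker_def subspace_0[OF subspace_TP])
  show "v + v' \<in> eta_ker x" if "v \<in> eta_ker x" "v' \<in> eta_ker x" for v v'
    using that etas_linear[of _ x 1 v v'] by (simp add: eta_ker_def subspace_add[OF subspace_TP])
  show "c *\<^sub>R v \<in> eta_ker x" if "v \<in> eta_ker x" for c v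
    using that etas_linear[of _ x c v 0] z by (simp add: eta_ker_def subspace_scale[OF subspace_TP])
qed

lemma linear_hor: "linear (\<lambda>(a, d). hor x (fst a) (snd a) d)"
  by (rule linearI) (auto simp: hor_def lie_mat_def vec_eq_iff all_6 forall_3 vector_3 algebra_simps)

lemma dim_eta_ker: "dim (eta_ker x) = 8"
proof -
  let ?h = "\<lambda>(a::real \<times> real, d). hor x (fst a) (snd a) d"
  have "inj ?h"
    by (rule injI) (metis (mono_tags, lifting) case_prod_beta' hor_coordinates(1,2,3) prod_eqI)
  then have "dim (range ?h) = dim (UNIV :: ((real \<times> real) \<times> (real^6)) set)"
    by (intro dim_image_eq[OF linear_hor]) (auto simp: inj_on_def)
  moreover have "range ?h = eta_ker x"
  proof
    show "range ?h \<subseteq> eta_ker x" by (auto simp: hor_in_eta_ker)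
    show "eta_ker x \<subseteq> range ?h"
    proof
      fix v assume "v \<in> eta_ker x"
      then have "v = ?h ((al1 v, al2 v), fst (snd v))"
        using eta_ker_eq_hor by simp
      then show "v \<in> range ?h" by (rule range_eqI)
    qed
  qed
  ultimately show ?thesis by simp
qed

section \<open>The derivatives of the sixteen forms on their kernel\<close>

text \<open>
The vectors dual to the \<open>\<eta>\<close> on which \<open>\<alpha>1\<close>, \<open>\<alpha>2\<close> and \<open>du\<close> vanish. They do not depend on the
point, because the coefficient functions in the \<open>\<eta>\<close> only multiply \<open>\<alpha>1\<close> and \<open>\<alpha>2\<close>.
\<close>

definition dual_frame :: "nat \<Rightarrow> tvec" where
  "dual_frame k = (let h = (\<lambda>j. if j = k then 1 else 0) in
     (lie_mat (h 8) (h 5) (h 6) (h 10) (h 12) (h 4) (h 9) (h 11) (h 7) (h 1) 0 0 (h 2) (h 3) (h 0),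
      0, vector [h 13, h 14, h 15]))"

lemma dual_frame_in_TP: "dual_frame k \<in> TP"
  by (simp add: dual_frame_def TP_def lie_mat_in_lie_alg Let_def)

lemma etas_dual_frame:
  assumes "j < 16"
  shows "(etas ! j) x [dual_frame k] = (if j = k then 1 else 0)"
proof -
  have "\<forall>j<16. (etas ! j) x [dual_frame k] = (if j = k then 1 else 0)"
    unfolding all_less_16 etas_eq al1_def al2_def dw_def dual_frame_def Let_def
    by (simp only: fst_conv snd_conv vector_3 lie_mat_def vec6_nth) simp
  then show ?thesis using assms by simp
qed

lemma ext_d_1: "ext_d 1 \<phi> x [v, v'] =
    Lder v (\<lambda>y. \<phi> y [v']) x - Lder v' (\<lambda>y. \<phi> y [v]) x - \<phi> x [bracket v v']"
  by (simp add: ext_d_def omit_def)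

lemma etas_has_derivative:
  "((\<lambda>t. (etas ! 0) (flow v t x) [v']) has_real_derivative 0) (at 0)"
  "((\<lambda>t. (etas ! 1) (flow v t x) [v']) has_real_derivative 0) (at 0)"
  "((\<lambda>t. (etas ! 2) (flow v t x) [v']) has_real_derivative 0) (at 0)"
  "((\<lambda>t. (etas ! 3) (flow v t x) [v']) has_real_derivative 0) (at 0)"
  "((\<lambda>t. (etas ! 4) (flow v t x) [v']) has_real_derivative 0) (at 0)"
  "((\<lambda>t. (etas ! 5) (flow v t x) [v']) has_real_derivative 0) (at 0)"
  "((\<lambda>t. (etas ! 6) (flow v t x) [v']) has_real_derivative 0) (at 0)"
  "((\<lambda>t. (etas ! 7) (flow v t x) [v']) has_real_derivative 0) (at 0)"
  "((\<lambda>t. (etas ! 8) (flow v t x) [v']) has_real_derivative 2 * du 1 v * al1 v' - du 2 v * al2 v') (at 0)"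
  "((\<lambda>t. (etas ! 9) (flow v t x) [v']) has_real_derivative du 1 v * al1 v' - 2 * du 2 v * al2 v') (at 0)"
  "((\<lambda>t. (etas ! 10) (flow v t x) [v']) has_real_derivative - du 5 v * al1 v' - du 4 v * al2 v') (at 0)"
  "((\<lambda>t. (etas ! 11) (flow v t x) [v']) has_real_derivative - du 3 v * al1 v' - du 6 v * al2 v') (at 0)"
  "((\<lambda>t. (etas ! 12) (flow v t x) [v']) has_real_derivative du 6 v * al1 v' - du 5 v * al2 v') (at 0)"
  "((\<lambda>t. (etas ! 13) (flow v t x) [v']) has_real_derivative
     - 2 * dw 1 v * (2 * q1 x * al1 v' - q2 x * al2 v')
     - 2 * w1 x * (2 * du 1 v * al1 v' - du 2 v * al2 v') - dw 3 v * al1 v') (at 0)"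
  "((\<lambda>t. (etas ! 14) (flow v t x) [v']) has_real_derivative
     - 2 * dw 2 v * (q1 x * al1 v' - 2 * q2 x * al2 v')
     - 2 * w2 x * (du 1 v * al1 v' - 2 * du 2 v * al2 v') + dw 3 v * al2 v') (at 0)"
  "((\<lambda>t. (etas ! 15) (flow v t x) [v']) has_real_derivative
     2 * dw 1 v * (p2 x - 1) * al2 v' + 2 * w1 x * du 4 v * al2 v'
     - 2 * dw 2 v * (p1 x - 1) * al1 v' - 2 * w2 x * du 3 v * al1 v'
     - 3 * dw 3 v * (q1 x * al1 v' - q2 x * al2 v')
     - 3 * w3 x * (du 1 v * al1 v' - du 2 v * al2 v')) (at 0)"
  unfolding etas_eq coordinates_flow
  by (auto intro!: derivative_eq_intros simp: algebra_simps)

lemmas Lder_etas = etas_has_derivative[THEN Lder_eqI[where f="\<lambda>y. (etas ! k) y [v']" for k v']]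

text \<open>
The wedge product of two coordinate 1-forms.
\<close>

definition minor :: "(tvec \<Rightarrow> real) \<Rightarrow> (tvec \<Rightarrow> real) \<Rightarrow> tvec \<Rightarrow> tvec \<Rightarrow> real" where
  "minor f g v v' = f v * g v' - f v' * g v"

text \<open>
The derivatives of \<open>\<eta>\<^sup>9, \<dots>, \<eta>\<^sup>1\<^sup>3\<close> and \<open>\<eta>\<^sup>1\<^sup>6\<close> modulo the \<open>\<eta>\<close>. The formula defines the six forms on
all of \<open>TP\<close>; it is the derivative only on \<open>eta_ker x\<close>.
\<close>

definition reduced_d_eta :: "pt \<Rightarrow> tvec \<Rightarrow> tvec \<Rightarrow> real^6" where
  "reduced_d_eta x v v' = vec6
     (2 * minor (du 1) al1 v v' - minor (du 2) al2 v v'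
        + (p2 x - 1 - q1 x * q2 x) * minor al1 al2 v v')
     (minor (du 1) al1 v v' - 2 * minor (du 2) al2 v v'
        - (p1 x - 1 - q1 x * q2 x) * minor al1 al2 v v')
     (- minor (du 5) al1 v v' - minor (du 4) al2 v v'
        + (3 * p2 x * q1 x + 2 * q2 x * r1 x) * minor al1 al2 v v')
     (- minor (du 3) al1 v v' - minor (du 6) al2 v v'
        + (2 * q1 x * r2 x + 3 * p1 x * q2 x) * minor al1 al2 v v')
     (minor (du 6) al1 v v' - minor (du 5) al2 v v'
        + 4 * (q1 x * r1 x - q2 x * r2 x) * minor al1 al2 v v')
     (2 * w1 x * minor (du 4) al2 v v' - 2 * w2 x * minor (du 3) al1 v v'
        - 3 * w3 x * (minor (du 1) al1 v v' - minor (du 2) al2 v v')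
        + 2 * w3 x * (p2 x - p1 x) * minor al1 al2 v v')"

lemma bracket_fst:
  "fst (bracket v v') $ i $ j = (fst v ** fst v') $ i $ j - (fst v' ** fst v) $ i $ j"
  "dw k (bracket v v') = 0"
  by (simp_all add: bracket_def dw_def)

lemma al_bracket: "al1 (bracket v v') = fst (bracket v v') $ 3 $ 0"
    "al2 (bracket v v') = fst (bracket v v') $ 2 $ 1"
  by (simp_all add: al1_def al2_def)

lemma hor_components:
  "fst (hor x a b d) = lie_mat (q2 x * b - 2 * q1 x * a) a 0 (r1 x * a + p2 x * b)
     (r1 x * b - r2 x * a) b (2 * q2 x * b - q1 x * a) (p1 x * a + r2 x * b) 0 0 b a 0 0 0"
  "dw 1 (hor x a b d) = 2 * w1 x * (2 * q1 x * a - q2 x * b) + w3 x * a"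
  "dw 2 (hor x a b d) = 2 * w2 x * (q1 x * a - 2 * q2 x * b) - w3 x * b"
  "dw 3 (hor x a b d) = 2 * w2 x * (p1 x - 1) * a - 2 * w1 x * (p2 x - 1) * b
     + 3 * w3 x * (q1 x * a - q2 x * b)"
  by (simp_all add: hor_def dw_def vector_3)

lemma all_8: "(\<forall>k<8. Q k) \<longleftrightarrow> Q 0 \<and> Q 1 \<and> Q 2 \<and> Q 3 \<and> Q 4 \<and> Q 5 \<and> Q 6 \<and> Q (7::nat)"
  by (simp add: numeral_eq_Suc All_less_Suc conj_ac)

lemma matrix_mult_nth: "(X ** Y) $ i $ j = (\<Sum>k\<in>UNIV. X $ i $ k * Y $ k $ j)"
  by (simp add: matrix_matrix_mult_def)

text \<open>
This is where the particular coefficients in \<open>\<eta>\<^sup>1\<^sup>4, \<eta>\<^sup>1\<^sup>5, \<eta>\<^sup>1\<^sup>6\<close> matter: with them the derivatives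
of \<open>\<eta>\<^sup>1\<^sup>4\<close> and \<open>\<eta>\<^sup>1\<^sup>5\<close> produce no equation beyond those of \<open>\<eta>\<^sup>9\<close> and \<open>\<eta>\<^sup>1\<^sup>0\<close>, not even a term in
\<open>\<alpha>1 \<and> \<alpha>2\<close>.
\<close>

lemma d_etas_hor:
  "(\<forall>k<8. ext_d 1 (etas ! k) x [hor x a b d, hor x a' b' d'] = 0)"
  "ext_d 1 (etas ! 8) x [hor x a b d, hor x a' b' d'] = reduced_d_eta x (hor x a b d) (hor x a' b' d') $ 0"
  "ext_d 1 (etas ! 9) x [hor x a b d, hor x a' b' d'] = reduced_d_eta x (hor x a b d) (hor x a' b' d') $ 1"
  "ext_d 1 (etas ! 10) x [hor x a b d, hor x a' b' d'] = reduced_d_eta x (hor x a b d) (hor x a' b' d') $ 2"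
  "ext_d 1 (etas ! 11) x [hor x a b d, hor x a' b' d'] = reduced_d_eta x (hor x a b d) (hor x a' b' d') $ 3"
  "ext_d 1 (etas ! 12) x [hor x a b d, hor x a' b' d'] = reduced_d_eta x (hor x a b d) (hor x a' b' d') $ 4"
  "ext_d 1 (etas ! 13) x [hor x a b d, hor x a' b' d'] = - 2 * w1 x * reduced_d_eta x (hor x a b d) (hor x a' b' d') $ 0"
  "ext_d 1 (etas ! 14) x [hor x a b d, hor x a' b' d'] = - 2 * w2 x * reduced_d_eta x (hor x a b d) (hor x a' b' d') $ 1"
  "ext_d 1 (etas ! 15) x [hor x a b d, hor x a' b' d'] = reduced_d_eta x (hor x a b d) (hor x a' b' d') $ 5"
  unfolding all_8 ext_d_1 Lder_etas
  unfolding etas_eq al_bracket bracket_fst hor_coordinates hor_components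
    matrix_mult_nth sum_6 lie_mat_def vec6_nth minor_def reduced_d_eta_def
  by (simp_all add: algebra_simps)

lemma reduced_d_eta_alternating: "reduced_d_eta x v v = 0" "reduced_d_eta x v' v = - reduced_d_eta x v v'"
  by (simp_all add: reduced_d_eta_def minor_def vec_eq_iff all_6 algebra_simps)

lemma reduced_d_eta_linear_left: "reduced_d_eta x (c *\<^sub>R v + v') v'' = c *\<^sub>R reduced_d_eta x v v'' + reduced_d_eta x v' v''"
  by (simp add: reduced_d_eta_def minor_def vec_eq_iff all_6 al1_def al2_def du_def algebra_simps)

lemma d_etas_zero_iff:
  assumes "v \<in> eta_ker x" "v' \<in> eta_ker x"
  shows "(\<forall>k<16. ext_d 1 (etas ! k) x [v, v'] = 0) \<longleftrightarrow> reduced_d_eta x v v' = 0"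
proof -
  obtain a b d a' b' d' where v: "v = hor x a b d" "v' = hor x a' b' d'"
    using assms eta_ker_eq_hor by metis
  show ?thesis
    using d_etas_hor(1)[of x a b d a' b' d']
    unfolding v all_less_16 d_etas_hor(2-) all_8 by (auto simp: vec_eq_iff all_6)
qed

section \<open>Forms of degree 1 and 2 in the ideal\<close>

lemma flow_0: "flow v 0 x = x"
proof -
  have "mexp (0 *\<^sub>R X) $ i $ j = mat 1 $ i $ j" for X :: "real^6^6" and i j
    unfolding mexp_entry powser_zero by (simp add: mpow_simps)
  then have "mexp (0 *\<^sub>R X) = mat 1" for X :: "real^6^6"
    by (simp add: vec_eq_iff)
  then show ?thesis
    by (simp add: flow_def split: prod.split)
qed

lemma Lder_has_derivative:
  assumes "(\<lambda>t. f (flow v t x)) differentiable (at 0)"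
  shows "((\<lambda>t. f (flow v t x)) has_real_derivative Lder v f x) (at 0)"
  unfolding Lder_def using assms by (simp add: DERIV_deriv_iff_real_differentiable)

lemma etas_differentiable:
  assumes "k < 16"
  shows "(\<lambda>t. (etas ! k) (flow v t x) [v']) differentiable (at 0)"
proof -
  have "\<forall>k<16. (\<lambda>t. (etas ! k) (flow v t x) [v']) differentiable (at 0)"
    unfolding all_less_16 real_differentiable_def by (intro conjI exI) (rule etas_has_derivative)+
  then show ?thesis using assms by simp
qed

text \<open>
The Leibniz rule: the terms in which a coefficient is differentiated carry a factor
\<open>\<eta> x [v]\<close> or \<open>\<eta> x [v']\<close>, which vanishes on the kernel.
\<close>

lemma ext_d_combination:
  assumes f: "\<And>k v. k < 16 \<Longrightarrow> v \<in> TP \<Longrightarrow> (\<lambda>t. f k (flow v t x)) differentiable (at 0)"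
    and \<phi>: "\<And>y v. \<phi> y [v] = (\<Sum>k<16. f k y * (etas ! k) y [v])"
    and v: "v \<in> eta_ker x" "v' \<in> eta_ker x"
  shows "ext_d 1 \<phi> x [v, v'] = (\<Sum>k<16. f k x * ext_d 1 (etas ! k) x [v, v'])"
proof -
  have L: "Lder v (\<lambda>y. \<phi> y [v']) x = (\<Sum>k<16. f k x * Lder v (\<lambda>y. (etas ! k) y [v']) x)"
    if "v \<in> eta_ker x" "v' \<in> eta_ker x" for v v'
  proof (rule Lder_eqI)
    have "((\<lambda>t. \<Sum>k<16. f k (flow v t x) * (etas ! k) (flow v t x) [v']) has_real_derivative
      (\<Sum>k<16. Lder v (f k) x * (etas ! k) (flow v 0 x) [v']
         + Lder v (\<lambda>y. (etas ! k) y [v']) x * f k (flow v 0 x))) (at 0)"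
      using that
      by (intro DERIV_sum DERIV_mult Lder_has_derivative f
          Lder_has_derivative[of "\<lambda>y. (etas ! k) y [v']" for k] etas_differentiable)
        (auto simp: eta_ker_def)
    also have "(\<Sum>k<16. Lder v (f k) x * (etas ! k) (flow v 0 x) [v']
         + Lder v (\<lambda>y. (etas ! k) y [v']) x * f k (flow v 0 x))
       = (\<Sum>k<16. f k x * Lder v (\<lambda>y. (etas ! k) y [v']) x)"
      using that by (intro sum.cong) (auto simp: flow_0 eta_ker_def)
    finally show "((\<lambda>t. \<phi> (flow v t x) [v']) has_real_derivative
        (\<Sum>k<16. f k x * Lder v (\<lambda>y. (etas ! k) y [v']) x)) (at 0)"
      unfolding \<phi> .
  qed
  show ?thesis
    unfolding ext_d_1 L[OF v] L[OF v(2,1)] \<phi>[of x "bracket v v'"]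
    by (simp add: algebra_simps sum.distrib sum_subtractf)
qed

lemma wedge_0_1: "wedge 0 (Suc 0) \<psi> \<phi> x [v] = \<psi> x [] * \<phi> x [v]"
proof -
  have "{\<sigma>. \<sigma> permutes {..<Suc 0}} = {id}"
    by (auto simp: lessThan_Suc)
  then show ?thesis by (simp add: wedge_def)
qed

lemma permutes_2: "{\<sigma>. \<sigma> permutes {..<Suc (Suc 0)}} = {id, Transposition.transpose 0 (Suc 0)}"
    "id \<noteq> Transposition.transpose 0 (Suc 0)"
  using permutes_doubleton_iff[of _ 0 "Suc 0"]
  by (auto simp: lessThan_Suc insert_commute) (metis id_apply n_not_Suc_n transpose_apply_first)

lemma wedge_0_2: "wedge 0 2 \<psi> \<phi> x [v, v'] = \<psi> x [] * (\<phi> x [v, v'] - \<phi> x [v', v]) / 2"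
  using permutes_2(2) by (simp add: wedge_def permutes_2 sign_swap_id numeral_2_eq_2 algebra_simps)

lemma wedge_1_1: "wedge (Suc 0) (Suc 0) \<psi> \<phi> x [v, v'] = \<psi> x [v] * \<phi> x [v'] - \<psi> x [v'] * \<phi> x [v]"
  using permutes_2(2) by (simp add: wedge_def permutes_2 sign_swap_id)

text \<open>
Induction over the generation of the ideal. A form of degree 1 only arises from the generators
by sums and by multiplication with functions, and a form of degree 2 by sums, by
multiplication, and as the derivative of a form of degree 1. The differentiability of the
coefficients is carried along because the last step differentiates them.
\<close>

lemma deformation_ideal_low_degree:
  assumes "(p, \<phi>) \<in> deformation_ideal"
  shows "0 < p"
    and "p = 1 \<Longrightarrow> \<exists>f. (\<forall>k<16. \<forall>x\<in>P. \<forall>v\<in>TP. (\<lambda>t. f k (flow v t x)) differentiable (at 0)) \<and>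
      (\<forall>y v. \<phi> y [v] = (\<Sum>k<16. f k y * (etas ! k) y [v]))"
    and "p = 2 \<Longrightarrow> \<forall>x\<in>P. \<forall>v\<in>eta_ker x. \<forall>v'\<in>eta_ker x. reduced_d_eta x v v' = 0 \<longrightarrow> \<phi> x [v, v'] = 0"
proof -
  define one where "one \<phi> f \<longleftrightarrow>
      (\<forall>k<16. \<forall>x\<in>P. \<forall>v\<in>TP. (\<lambda>t. f k (flow v t x)) differentiable (at 0)) \<and>
      (\<forall>y v. \<phi> y [v] = (\<Sum>k<16. f k y * (etas ! k) y [v]))"
    for \<phi> :: form and f :: "nat \<Rightarrow> pt \<Rightarrow> real"
  define two where "two \<phi> \<longleftrightarrow>
      (\<forall>x\<in>P. \<forall>v\<in>eta_ker x. \<forall>v'\<in>eta_ker x. reduced_d_eta x v v' = 0 \<longrightarrow> \<phi> x [v, v'] = 0)" for \<phi> :: form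
  have "0 < p \<and> (p = 1 \<longrightarrow> (\<exists>f. one \<phi> f)) \<and> (p = 2 \<longrightarrow> two \<phi>)"
    using assms unfolding deformation_ideal_def
  proof (induction p \<phi> rule: diff_ideal.induct[split_format (complete)])
    case (gen p \<phi>)
    then obtain j where p: "p = 1" and j: "j < 16" "\<phi> = etas ! j"
      by (auto simp: in_set_conv_nth length_etas)
    have "(\<Sum>k<16. (if k = j then 1 else 0) * g k) = g j" for g :: "nat \<Rightarrow> real"
      using j by (subst sum.remove[of _ j]) auto
    then have "one \<phi> (\<lambda>k y. if k = j then 1 else 0)"
      using j by (simp add: one_def)
    with p show ?case by auto
  next
    case (add p \<phi> \<psi>)
    have "\<exists>h. one (\<lambda>x vs. \<phi> x vs + \<psi> x vs) h" if "one \<phi> f" "one \<psi> g" for f g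
      using that
      by (intro exI[of _ "\<lambda>k y. f k y + g k y"]) (auto simp: one_def sum.distrib distrib_right)
    with add.IH show ?case by (auto simp: two_def)
  next
    case (mult q \<psi> p \<phi>)
    have w01: "\<exists>h. one (wedge 0 1 \<psi> \<phi>) h" if "one \<phi> f" "q = 0" for f
    proof -
      have "smooth (\<lambda>x. \<psi> x [])"
        using mult.hyps \<open>q = 0\<close> by (simp add: smooth_form_def)
      then have "Ck (Suc 0) (\<lambda>x. \<psi> x [])"
        unfolding smooth_def by blast
      then show ?thesis
        using that
        by (intro exI[of _ "\<lambda>k y. \<psi> y [] * f k y"])
          (auto simp: one_def wedge_0_1 sum_distrib_left mult.assoc)
    qed
    have w02: "two (wedge 0 2 \<psi> \<phi>)" if "two \<phi>"
    proof -
      have "reduced_d_eta x v' v = 0" if "reduced_d_eta x v v' = 0" for x v v'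
        using that reduced_d_eta_alternating(2)[of x v' v] by simp
      then show ?thesis
        using that by (simp add: two_def wedge_0_2)
    qed
    have w11: "two (wedge 1 1 \<psi> \<phi>)" if "one \<phi> f" for f
    proof -
      have "\<phi> x [v] = 0" if "v \<in> eta_ker x" for x v
      proof -
        have "\<phi> x [v] = (\<Sum>k<16. f k x * (etas ! k) x [v])"
          using \<open>one \<phi> f\<close> unfolding one_def by blast
        with that show ?thesis by (simp add: eta_ker_def)
      qed
      then show ?thesis
        by (simp add: two_def wedge_1_1)
    qed
    have "0 < p"
      using mult.IH by simp
    show ?case
    proof (intro conjI impI)
      show "0 < q + p"
        using \<open>0 < p\<close> by simp
      show "\<exists>f. one (wedge q p \<psi> \<phi>) f" if "q + p = 1"
      proof -
        have "q = 0" "p = 1" using that \<open>0 < p\<close> by auto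
        then show ?thesis using mult.IH w01 by blast
      qed
      show "two (wedge q p \<psi> \<phi>)" if "q + p = 2"
      proof -
        have "q = 0 \<and> p = 2 \<or> q = 1 \<and> p = 1"
          using that \<open>0 < p\<close> by linarith
        then show ?thesis using mult.IH w02 w11 by blast
      qed
    qed
  next
    case (deriv p \<phi>)
    have "two (ext_d 1 \<phi>)" if "one \<phi> f" for f
      unfolding two_def
    proof (intro ballI impI)
      fix x v v' assume x: "x \<in> P" "v \<in> eta_ker x" "v' \<in> eta_ker x" and c: "reduced_d_eta x v v' = 0"
      then have "ext_d 1 \<phi> x [v, v'] = (\<Sum>k<16. f k x * ext_d 1 (etas ! k) x [v, v'])"
        using that by (intro ext_d_combination) (auto simp: one_def)
      also have "\<dots> = 0"
        using c d_etas_zero_iff[OF x(2,3)] by (intro sum.neutral) auto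
      finally show "ext_d 1 \<phi> x [v, v'] = 0" .
    qed
    then show ?case
      using deriv.IH by auto
  qed
  then show "0 < p"
    and "p = 1 \<Longrightarrow> \<exists>f. (\<forall>k<16. \<forall>x\<in>P. \<forall>v\<in>TP. (\<lambda>t. f k (flow v t x)) differentiable (at 0)) \<and>
      (\<forall>y v. \<phi> y [v] = (\<Sum>k<16. f k y * (etas ! k) y [v]))"
    and "p = 2 \<Longrightarrow> \<forall>x\<in>P. \<forall>v\<in>eta_ker x. \<forall>v'\<in>eta_ker x. reduced_d_eta x v v' = 0 \<longrightarrow> \<phi> x [v, v'] = 0"
    unfolding one_def two_def by simp_all
qed

lemma ideal_1_zero_on_eta_ker:
  assumes "(1, \<phi>) \<in> deformation_ideal" "v \<in> eta_ker x"
  shows "\<phi> x [v] = 0"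
proof -
  obtain f where "\<And>y v. \<phi> y [v] = (\<Sum>k<16. f k y * (etas ! k) y [v])"
    using deformation_ideal_low_degree(2)[OF assms(1)] by blast
  then show ?thesis using assms(2) by (simp add: eta_ker_def)
qed

lemma etas_in_ideal: "k < 16 \<Longrightarrow> (1, etas ! k) \<in> deformation_ideal"
  unfolding deformation_ideal_def by (intro diff_ideal.gen imageI) (simp add: length_etas)

lemma d_etas_in_ideal: "k < 16 \<Longrightarrow> (2, ext_d 1 (etas ! k)) \<in> deformation_ideal"
  using diff_ideal.deriv[OF etas_in_ideal[unfolded deformation_ideal_def]]
  by (simp add: deformation_ideal_def numeral_2_eq_2)

section \<open>Open sets of \<open>P\<close> and constant forms\<close>

lemma istopology_P_top: "istopology (\<lambda>U. U \<subseteq> P \<and>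
     openin (top_of_set (G \<times> UNIV \<times> UNIV)) {a \<in> G \<times> UNIV \<times> UNIV. proj a \<in> U})"
  unfolding istopology_def
proof (intro conjI allI impI)
  fix S T
  assume "S \<subseteq> P \<and> openin (top_of_set (G \<times> UNIV \<times> UNIV)) {a \<in> G \<times> UNIV \<times> UNIV. proj a \<in> S}"
    "T \<subseteq> P \<and> openin (top_of_set (G \<times> UNIV \<times> UNIV)) {a \<in> G \<times> UNIV \<times> UNIV. proj a \<in> T}"
  moreover have "{a \<in> G \<times> UNIV \<times> UNIV. proj a \<in> S \<inter> T} =
      {a \<in> G \<times> UNIV \<times> UNIV. proj a \<in> S} \<inter> {a \<in> G \<times> UNIV \<times> UNIV. proj a \<in> T}"
    by blast
  ultimately show "S \<inter> T \<subseteq> P"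
      "openin (top_of_set (G \<times> UNIV \<times> UNIV)) {a \<in> G \<times> UNIV \<times> UNIV. proj a \<in> S \<inter> T}"
    by (auto intro: openin_Int)
next
  fix \<K>
  assume K: "\<forall>U\<in>\<K>. U \<subseteq> P \<and>
    openin (top_of_set (G \<times> UNIV \<times> UNIV)) {a \<in> G \<times> UNIV \<times> UNIV. proj a \<in> U}"
  then show "\<Union>\<K> \<subseteq> P" by blast
  have "{a \<in> G \<times> UNIV \<times> UNIV. proj a \<in> \<Union>\<K>} =
      (\<Union>U\<in>\<K>. {a \<in> G \<times> UNIV \<times> UNIV. proj a \<in> U})"
    by blast
  with K show "openin (top_of_set (G \<times> UNIV \<times> UNIV)) {a \<in> G \<times> UNIV \<times> UNIV. proj a \<in> \<Union>\<K>}"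
    by auto
qed

lemma openin_P_top: "openin P_top U \<longleftrightarrow> U \<subseteq> P \<and>
     openin (top_of_set (G \<times> UNIV \<times> UNIV)) {a \<in> G \<times> UNIV \<times> UNIV. proj a \<in> U}"
  unfolding P_top_def by (simp only: topology_inverse'[OF istopology_P_top])

lemma openin_P_top_w:
  assumes "open W"
  shows "openin P_top {x \<in> P. snd (snd x) \<in> W}"
proof -
  have "{a \<in> G \<times> UNIV \<times> UNIV. proj a \<in> {x \<in> P. snd (snd x) \<in> W}}
      = (G \<times> UNIV \<times> UNIV) \<inter> (UNIV \<times> UNIV \<times> W)"
    by (auto simp: P_def proj_def)
  moreover have "open (UNIV \<times> UNIV \<times> W :: tvec set)"
    using assms by (intro open_Times) auto
  ultimately show ?thesis
    unfolding openin_P_top by (auto simp: openin_open)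
qed

lemma openin_P: "openin P_top P"
  using openin_P_top_w[of UNIV] by simp

lemma topspace_P_top: "topspace P_top = P"
proof
  show "topspace P_top \<subseteq> P"
    using openin_topspace[of P_top] by (simp only: openin_P_top)
  show "P \<subseteq> topspace P_top"
    by (rule openin_subset[OF openin_P])
qed

text \<open>
The fibre directions \<open>\<real>\<^sup>6 \<times> \<real>\<^sup>3\<close> are untouched by the quotient, so the topology of \<open>P\<close> restricts to
the usual one along them. All perturbations of points below move \<open>w\<close> only.
\<close>

lemma eventually_in_open:
  assumes "openin P_top U" "(C, u, w) \<in> U"
  shows "eventually (\<lambda>w'. (C, u, w') \<in> U) (nhds w)"
proof -
  obtain A where A: "A \<in> G" "C = {A, - A}"
    using assms by (auto simp: openin_P_top P_def proj_def)
  obtain T where T: "open T" "{a \<in> G \<times> UNIV \<times> UNIV. proj a \<in> U} = (G \<times> UNIV \<times> UNIV) \<inter> T"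
    using assms(1) by (auto simp: openin_P_top openin_open)
  have iff: "(A, u, w') \<in> T \<longleftrightarrow> (C, u, w') \<in> U" for w'
  proof -
    have "(A, u, w') \<in> {a \<in> G \<times> UNIV \<times> UNIV. proj a \<in> U} \<longleftrightarrow> (C, u, w') \<in> U"
      using A by (simp add: proj_def)
    then show ?thesis using A(1) unfolding T(2) by simp
  qed
  have "open ((\<lambda>w'. (A, u, w')) -` T)"
    by (intro open_vimage T continuous_intros)
  then have "eventually (\<lambda>w'. w' \<in> (\<lambda>w'. (A, u, w')) -` T) (nhds w)"
    using assms(2) by (intro eventually_nhds_in_open) (simp_all add: iff)
  then show ?thesis
    by (simp add: iff)
qed

lemma smooth_const: "smooth (\<lambda>x. c)"
proof -
  have "Ck k (\<lambda>x. c)" for k c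
  proof (induction k arbitrary: c)
    case (Suc k)
    have "Lder v (\<lambda>x. c) = (\<lambda>x. 0)" for v
      by (rule ext) (simp add: Lder_def)
    with Suc show ?case by simp
  qed simp
  then show ?thesis by (simp add: smooth_def)
qed

lemma smooth_form_\<alpha>1: "smooth_form 1 \<alpha>1"
  unfolding smooth_form_def
proof (intro allI impI conjI ballI)
  fix vs :: "tvec list" assume "length vs = 1 \<and> set vs \<subseteq> TP"
  then obtain v where vs: "vs = [v]"
    by (auto simp: length_Suc_conv)
  show "smooth (\<lambda>x. \<alpha>1 x vs)"
    by (simp add: vs alpha_eq smooth_const)
  show "\<alpha>1 x (vs[i := c *\<^sub>R v + c' *\<^sub>R v']) = c * \<alpha>1 x (vs[i := v]) + c' * \<alpha>1 x (vs[i := v'])"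
    if "i < 1" for x i v v' c c'
    using that by (simp add: vs alpha_eq al1_def)
qed auto

section \<open>Non-characteristic directions\<close>

abbreviation (input) \<I> where "\<I> \<equiv> deformation_ideal"

text \<open>
Up to powers of \<open>\<alpha>1\<close> and \<open>\<alpha>2\<close> and a constant, the determinant of the linear system for \<open>du\<close> in
\<open>reduced_d_eta_vertical_injective\<close>. Its zeros are the characteristic directions. Of the point it
involves the component \<open>w\<close> only.
\<close>

definition char_form :: "real^3 \<Rightarrow> tvec \<Rightarrow> real" where
  "char_form w v = al1 v * al2 v * (w $ 2 * (al2 v)\<^sup>2 - w $ 1 * (al1 v)\<^sup>2)"

definition generic :: "pt \<Rightarrow> tvec \<Rightarrow> bool" where
  "generic x v \<longleftrightarrow> char_form (snd (snd x)) v \<noteq> 0"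

lemma generic_alt: "generic x v \<longleftrightarrow>
    al1 v \<noteq> 0 \<and> al2 v \<noteq> 0 \<and> w2 x * (al2 v)\<^sup>2 - w1 x * (al1 v)\<^sup>2 \<noteq> 0"
  by (simp add: generic_def char_form_def w1_def w2_def)

text \<open>
With \<open>(a, b) = (\<alpha>1 e, \<alpha>2 e)\<close>, the first two equations give \<open>du\<^sub>1 = du\<^sub>2 = 0\<close>; the next three
express \<open>du\<^sub>3, du\<^sub>4, du\<^sub>6\<close> through \<open>du\<^sub>5\<close>; the last one then reads \<open>du\<^sub>5 (w2 b\<^sup>2 - w1 a\<^sup>2) = 0\<close>.
\<close>

lemma reduced_d_eta_vertical_injective:
  assumes g: "generic x e" and c: "reduced_d_eta x (hor x 0 0 d) e = 0"
  shows "d = 0"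
proof -
  define A B where "A = al1 e" and "B = al2 e"
  have nz: "A \<noteq> 0" "B \<noteq> 0" "w2 x * B\<^sup>2 - w1 x * A\<^sup>2 \<noteq> 0"
    using g by (simp_all add: generic_alt A_def B_def)
  have eqs: "2 * (d $ 1 * A) = d $ 2 * B" "d $ 1 * A = 2 * (d $ 2 * B)"
      "d $ 4 * B = - (d $ 5 * A)" "d $ 3 * A = - (d $ 6 * B)" "d $ 6 * A = d $ 5 * B"
      "2 * w1 x * (d $ 4 * B) - 2 * w2 x * (d $ 3 * A) - 3 * w3 x * (d $ 1 * A - d $ 2 * B) = 0"
  proof -
    have "reduced_d_eta x (hor x 0 0 d) e $ i = 0" for i
      using c by simp
    note m = this[of 0] this[of 1] this[of 2] this[of 3] this[of 4] this[of 5]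
    show "2 * (d $ 1 * A) = d $ 2 * B" "d $ 1 * A = 2 * (d $ 2 * B)"
      "d $ 4 * B = - (d $ 5 * A)" "d $ 3 * A = - (d $ 6 * B)" "d $ 6 * A = d $ 5 * B"
      "2 * w1 x * (d $ 4 * B) - 2 * w2 x * (d $ 3 * A) - 3 * w3 x * (d $ 1 * A - d $ 2 * B) = 0"
      using m unfolding reduced_d_eta_def vec6_nth minor_def hor_coordinates A_def B_def
        mult_zero_left mult_zero_right diff_0_right add_0_right
      by linarith+
  qed
  have d12: "d $ 1 * A = 0" "d $ 2 * B = 0"
    using eqs(1,2) by linarith+
  then have "w1 x * (d $ 5 * A) = w2 x * (d $ 6 * B)"
    using eqs(6) unfolding eqs(3,4) d12 by simp
  then have "w1 x * (d $ 5 * A) * A = w2 x * (d $ 6 * A) * B"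
    by simp
  then have "d $ 5 * (w2 x * B\<^sup>2 - w1 x * A\<^sup>2) = 0"
    unfolding eqs(5) by (auto simp: algebra_simps power2_eq_square)
  then have "d $ 5 = 0"
    using nz by simp
  then have "d $ 1 = 0" "d $ 2 = 0" "d $ 3 = 0" "d $ 4 = 0" "d $ 5 = 0" "d $ 6 = 0"
    using nz eqs(3-5) d12 by simp_all
  then show ?thesis
    by (simp add: vec_eq_iff all_6 six_zero)
qed

text \<open>
The polar space of the line spanned by \<open>e\<close>, by \<open>polar_space_1\<close> below.
\<close>

definition char_plane :: "pt \<Rightarrow> tvec \<Rightarrow> tvec set" where
  "char_plane x e = {v \<in> eta_ker x. reduced_d_eta x v e = 0}"

lemma reduced_d_eta_zero_left: "reduced_d_eta x 0 v = 0"
  using reduced_d_eta_linear_left[of x "-1" v v v] by simp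

lemma subspace_char_plane: "subspace (char_plane x e)"
proof (rule subspaceI)
  note closed = subspace_0[OF subspace_eta_ker] subspace_add[OF subspace_eta_ker] subspace_scale[OF subspace_eta_ker]
  show "0 \<in> char_plane x e"
    by (simp add: char_plane_def closed reduced_d_eta_zero_left)
  show "v + v' \<in> char_plane x e" if "v \<in> char_plane x e" "v' \<in> char_plane x e" for v v'
    using that reduced_d_eta_linear_left[of x 1 v v' e] by (simp add: char_plane_def closed)
  show "c *\<^sub>R v \<in> char_plane x e" if "v \<in> char_plane x e" for c v
    using that reduced_d_eta_linear_left[of x c v 0 e] by (simp add: char_plane_def closed reduced_d_eta_zero_left)
qed

lemma char_plane_inj:
  assumes "generic x e" "v \<in> char_plane x e" "al1 v = 0" "al2 v = 0"
  shows "v = 0"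
proof -
  have v: "v = hor x 0 0 (fst (snd v))"
    using assms eta_ker_eq_hor[of v x] by (simp add: char_plane_def)
  have "reduced_d_eta x (hor x 0 0 (fst (snd v))) e = 0"
    unfolding v[symmetric] using assms(2) by (simp add: char_plane_def)
  then have "fst (snd v) = 0"
    by (rule reduced_d_eta_vertical_injective[OF assms(1)])
  then have "v = hor x 0 0 0"
    using v by simp
  also have "\<dots> = 0"
    by (simp add: hor_def lie_mat_def vec_eq_iff all_6 forall_3 vector_3 zero_prod_def)
  finally show ?thesis .
qed

text \<open>
The terms of \<open>reduced_d_eta\<close> in \<open>\<alpha>1 \<and> \<alpha>2\<close> only contribute an inhomogeneity, and an injective
linear endomorphism of \<open>\<real>\<^sup>6\<close> is surjective.
\<close>

lemma char_plane_surj: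
  assumes "generic x e"
  obtains v where "v \<in> char_plane x e" "al1 v = a" "al2 v = b"
proof -
  let ?L = "\<lambda>d. reduced_d_eta x (hor x 0 0 d) e"
  have h: "hor x (c * a + a') (c * b + b') (c *\<^sub>R d + d') = c *\<^sub>R hor x a b d + hor x a' b' d'"
    for c a b a' b' d d'
    by (simp add: hor_def lie_mat_def vec_eq_iff all_6 forall_3 vector_3 algebra_simps)
  have L: "?L (c *\<^sub>R d + d') = c *\<^sub>R ?L d + ?L d'" for c d d'
    using h[of c 0 0 0 0 d d'] by (simp add: reduced_d_eta_linear_left)
  have lin: "linear ?L"
  proof (rule linearI)
    show "?L (d + d') = ?L d + ?L d'" for d d'
      using L[of 1 d d'] by simp
    show "?L (c *\<^sub>R d) = c *\<^sub>R ?L d" for c d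
      using L[of c d 0] L[of 1 0 0] by simp
  qed
  moreover have "inj ?L"
    unfolding linear_injective_0[OF lin] using assms reduced_d_eta_vertical_injective by blast
  ultimately have "surj ?L"
    by (rule linear_injective_imp_surjective) simp
  then have "- reduced_d_eta x (hor x a b 0) e \<in> range ?L"
    by simp
  then obtain d where d: "- reduced_d_eta x (hor x a b 0) e = ?L d"
    by (rule rangeE)
  have "hor x a b d = 1 *\<^sub>R hor x a b 0 + hor x 0 0 d"
    using h[of 1 a 0 b 0 0 d] by simp
  then have "reduced_d_eta x (hor x a b d) e = 0"
    by (simp only: reduced_d_eta_linear_left d[symmetric]) simp
  then have "hor x a b d \<in> char_plane x e"
    by (simp add: char_plane_def hor_in_eta_ker)
  then show ?thesis
    by (rule that) (simp_all add: hor_coordinates)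
qed

lemma dim_char_plane:
  assumes "generic x e"
  shows "dim (char_plane x e) = 2"
proof -
  let ?f = "\<lambda>v. (al1 v, al2 v)"
  have lin: "linear ?f"
    by (rule linearI) (simp_all add: al1_def al2_def)
  have "inj_on ?f (span (char_plane x e))"
    unfolding span_eq_iff[THEN iffD2, OF subspace_char_plane]
      linear_inj_on_iff_eq_0[OF lin subspace_char_plane]
  proof (intro ballI impI)
    fix v assume "v \<in> char_plane x e" "?f v = 0"
    then show "v = 0"
      using char_plane_inj[OF assms, of v] by (simp only: zero_prod_def prod.inject)
  qed
  then have "dim (?f ` char_plane x e) = dim (char_plane x e)"
    by (rule dim_image_eq[OF lin])
  moreover have "?f ` char_plane x e = UNIV"
  proof (intro equalityI subsetI UNIV_I)
    fix c :: "real \<times> real"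
    obtain v where "v \<in> char_plane x e" "al1 v = fst c" "al2 v = snd c"
      using char_plane_surj[OF assms] .
    then show "c \<in> ?f ` char_plane x e"
      by (auto intro!: image_eqI[of _ _ v])
  qed
  ultimately show ?thesis by simp
qed

text \<open>
The plane is spanned by \<open>e\<close> and one more vector \<open>f\<close>, and an alternating bilinear map with
\<open>reduced_d_eta x f e = 0\<close> vanishes on the span of \<open>e\<close> and \<open>f\<close>.
\<close>

lemma char_plane_isotropic:
  assumes g: "generic x e" and e: "e \<in> eta_ker x" and v: "v \<in> char_plane x e" "v' \<in> char_plane x e"
  shows "reduced_d_eta x v v' = 0"
proof -
  obtain f where f: "f \<in> char_plane x e" "al1 f = 0" "al2 f = 1"
    using char_plane_surj[OF g] .
  have nz: "al1 e \<noteq> 0" using g by (simp add: generic_alt)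
  have e': "e \<in> char_plane x e"
    using e by (simp add: char_plane_def reduced_d_eta_alternating(1))
  have ex: "\<exists>s t. v = s *\<^sub>R e + t *\<^sub>R f" if v: "v \<in> char_plane x e" for v
  proof -
    define s where "s = al1 v / al1 e"
    define t where "t = al2 v - s * al2 e"
    have "v - (s *\<^sub>R e + t *\<^sub>R f) = 0"
    proof (rule char_plane_inj[OF g])
      show "v - (s *\<^sub>R e + t *\<^sub>R f) \<in> char_plane x e"
        using v e' f(1)
        by (intro subspace_diff subspace_add subspace_scale subspace_char_plane)
      have "al1 (v - (s *\<^sub>R e + t *\<^sub>R f)) = al1 v - (s * al1 e + t * al1 f)"
          "al2 (v - (s *\<^sub>R e + t *\<^sub>R f)) = al2 v - (s * al2 e + t * al2 f)"
        by (simp_all add: al1_def al2_def)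
      then show "al1 (v - (s *\<^sub>R e + t *\<^sub>R f)) = 0" "al2 (v - (s *\<^sub>R e + t *\<^sub>R f)) = 0"
        using nz f by (simp_all add: s_def t_def)
    qed
    then show ?thesis by (metis eq_iff_diff_eq_0)
  qed
  have lin: "reduced_d_eta x (s *\<^sub>R e + t *\<^sub>R f) v'' = s *\<^sub>R reduced_d_eta x e v'' + t *\<^sub>R reduced_d_eta x f v''" for s t v''
    using reduced_d_eta_linear_left[of x t f 0 v''] by (simp add: reduced_d_eta_linear_left reduced_d_eta_zero_left)
  obtain s t where st: "v = s *\<^sub>R e + t *\<^sub>R f"
    using ex v by metis
  obtain s' t' where st': "v' = s' *\<^sub>R e + t' *\<^sub>R f"
    using ex v by metis
  have "reduced_d_eta x e f = 0"
    using f(1) reduced_d_eta_alternating(2)[of x e f] by (simp add: char_plane_def)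
  then have "reduced_d_eta x v' f = 0"
    unfolding st' lin by (simp add: reduced_d_eta_alternating(1))
  then have "reduced_d_eta x f v' = 0"
    using reduced_d_eta_alternating(2)[of x f v'] by simp
  moreover have "reduced_d_eta x e v' = 0"
    using v(2) reduced_d_eta_alternating(2)[of x e v'] by (simp add: char_plane_def)
  ultimately show ?thesis
    unfolding st lin by simp
qed

section \<open>Polar spaces and integral elements\<close>

lemma ideal_2_zero:
  assumes "(2, \<phi>) \<in> \<I>" "x \<in> P" "v \<in> eta_ker x" "v' \<in> eta_ker x" "reduced_d_eta x v v' = 0"
  shows "\<phi> x [v, v'] = 0"
  using deformation_ideal_low_degree(3)[OF assms(1) refl] assms(2-5) by blast

lemma polar_space_0: "polar_space \<I> 0 x E = eta_ker x"
proof (intro equalityI subsetI)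
  fix v assume v: "v \<in> polar_space \<I> 0 x E"
  have "(etas ! k) x [v] = 0" if "k < 16" for k
    using v etas_in_ideal[OF that] by (auto simp: polar_space_def)
  then show "v \<in> eta_ker x"
    using v by (simp add: eta_ker_def polar_space_def)
next
  fix v assume v: "v \<in> eta_ker x"
  then show "v \<in> polar_space \<I> 0 x E"
    using ideal_1_zero_on_eta_ker[OF _ v] by (auto simp: polar_space_def eta_ker_def)
qed

lemma polar_space_1:
  assumes x: "x \<in> P" and e: "e \<in> eta_ker x" "al1 e \<noteq> 0"
  shows "polar_space \<I> 1 x (span {e}) = char_plane x e"
proof (intro equalityI subsetI)
  fix v assume v: "v \<in> polar_space \<I> 1 x (span {e})"
  have I2: "\<phi> x [v, e] = 0" if "(2, \<phi>) \<in> \<I>" for \<phi>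
    using v that by (auto simp: polar_space_def span_base numeral_2_eq_2 dest!: spec[of _ \<phi>] spec[of _ "[e]"])
  have "(etas ! k) x [v] = 0" if k: "k < 16" for k
  proof -
    \<comment> \<open>The polar space is formed in \<open>TP\<close>, so \<open>\<eta> x [v] = 0\<close> must come from a 2-form: as \<open>\<eta>\<close> vanishes on
      \<open>e\<close>, the value of \<open>\<alpha>1 \<and> \<eta>\<close> at \<open>(v, e)\<close> is \<open>-\<alpha>1 e\<close> times \<open>\<eta> x [v]\<close>.\<close>
    have "(1 + 1, wedge 1 1 \<alpha>1 (etas ! k)) \<in> \<I>"
      using etas_in_ideal[OF k] unfolding deformation_ideal_def
      by (intro diff_ideal.mult smooth_form_\<alpha>1)
    then have "al1 v * (etas ! k) x [e] - al1 e * (etas ! k) x [v] = 0"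
      using I2[of "wedge 1 1 \<alpha>1 (etas ! k)"] by (simp add: wedge_1_1 alpha_eq numeral_2_eq_2)
    then show ?thesis
      using e k by (simp add: eta_ker_def)
  qed
  then have vk: "v \<in> eta_ker x"
    using v by (simp add: eta_ker_def polar_space_def)
  moreover have "reduced_d_eta x v e = 0"
    using I2[OF d_etas_in_ideal] d_etas_zero_iff[OF vk e(1)] by simp
  ultimately show "v \<in> char_plane x e"
    by (simp add: char_plane_def)
next
  fix v assume v: "v \<in> char_plane x e"
  show "v \<in> polar_space \<I> 1 x (span {e})"
    unfolding polar_space_def
  proof (intro CollectI conjI allI impI)
    show "v \<in> TP"
      using v by (simp add: char_plane_def eta_ker_def)
    fix \<phi> vs assume a: "(Suc 1, \<phi>) \<in> \<I> \<and> length vs = 1 \<and> set vs \<subseteq> span {e}"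
    then obtain v' where "vs = [v']" "v' \<in> span {e}"
      by (auto simp: length_Suc_conv)
    then obtain c where vs: "vs = [c *\<^sub>R e]"
      unfolding span_singleton by blast
    have "reduced_d_eta x (c *\<^sub>R e) v = c *\<^sub>R reduced_d_eta x e v"
      using reduced_d_eta_linear_left[of x c e 0 v] by (simp add: reduced_d_eta_zero_left)
    also have "\<dots> = 0"
      using v reduced_d_eta_alternating(2)[of x e v] by (simp add: char_plane_def)
    finally have "reduced_d_eta x v (c *\<^sub>R e) = 0"
      using reduced_d_eta_alternating(2)[of x v "c *\<^sub>R e"] by simp
    moreover have "(2, \<phi>) \<in> \<I>"
      using a by (simp add: numeral_2_eq_2)
    moreover have "v \<in> eta_ker x" "c *\<^sub>R e \<in> eta_ker x"
      using v e(1) subspace_scale[OF subspace_eta_ker] by (auto simp: char_plane_def)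
    ultimately show "\<phi> x (v # vs) = 0"
      unfolding vs using x by (intro ideal_2_zero)
  qed
qed

lemma eta_ker_subset_TP: "eta_ker x \<subseteq> TP"
  by (auto simp: eta_ker_def)

lemma integral_element_0: "integral_element \<I> 0 x {0} \<longleftrightarrow> x \<in> P"
proof -
  have "\<not> (\<exists>\<phi>. (0, \<phi>) \<in> \<I>)"
    using deformation_ideal_low_degree(1) by blast
  then show ?thesis
    by (simp add: integral_element_def subspace_single_0 subspace_0[OF subspace_TP])
qed

lemma integral_element_subset_eta_ker:
  assumes "integral_element \<I> p x E" "0 < p"
  shows "E \<subseteq> eta_ker x"
proof
  fix v assume v: "v \<in> E"
  have "(etas ! k) x [v] = 0" if "k < 16" for k
  proof -
    have "1 \<le> p \<and> length [v] = 1 \<and> set [v] \<subseteq> E"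
      using assms(2) v by simp
    with etas_in_ideal[OF that] assms(1) show ?thesis
      unfolding integral_element_def by blast
  qed
  then show "v \<in> eta_ker x"
    using assms v by (auto simp: eta_ker_def integral_element_def)
qed

lemma integral_element_1:
  assumes "e \<noteq> 0"
  shows "integral_element \<I> 1 x (span {e}) \<longleftrightarrow> x \<in> P \<and> e \<in> eta_ker x"
proof
  assume "integral_element \<I> 1 x (span {e})"
  then show "x \<in> P \<and> e \<in> eta_ker x"
    using integral_element_subset_eta_ker[of 1 x "span {e}"]
    by (auto simp: integral_element_def span_base)
next
  assume xe: "x \<in> P \<and> e \<in> eta_ker x"
  then have sub: "span {e} \<subseteq> eta_ker x"
    by (intro span_minimal) (auto simp: subspace_eta_ker)
  have "dim (span {e}) = 1"
    using assms dim_eq_card_independent[of "{e}"] by simp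
  moreover have "\<phi> x vs = 0" if "(q, \<phi>) \<in> \<I>" "q \<le> 1" "length vs = q" "set vs \<subseteq> span {e}" for q \<phi> vs
  proof -
    have q: "q = 1"
      using that deformation_ideal_low_degree(1)[OF that(1)] by simp
    with that obtain v where "vs = [v]"
      by (auto simp: length_Suc_conv)
    then show ?thesis
      using that sub q ideal_1_zero_on_eta_ker[of \<phi> v x] by auto
  qed
  moreover have "span {e} \<subseteq> TP"
    using sub eta_ker_subset_TP by blast
  ultimately show "integral_element \<I> 1 x (span {e})"
    using xe unfolding integral_element_def by (intro conjI allI impI subspace_span) blast+
qed

lemma integral_element_2:
  assumes x: "x \<in> P" and e: "e \<in> eta_ker x" and g: "generic x e"
  shows "integral_element \<I> 2 x (char_plane x e)"
proof -
  have "\<phi> x vs = 0"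
    if "(q, \<phi>) \<in> \<I>" "q \<le> 2" "length vs = q" "set vs \<subseteq> char_plane x e" for q \<phi> vs
  proof -
    have "0 < q"
      using that deformation_ideal_low_degree(1) by blast
    then consider "q = 1" | "q = 2"
      using \<open>q \<le> 2\<close> by linarith
    then show ?thesis
    proof cases
      case 1
      with that obtain v where "vs = [v]"
        by (auto simp: length_Suc_conv)
      then show ?thesis
        using that 1 ideal_1_zero_on_eta_ker[of \<phi> v x] by (simp add: char_plane_def)
    next
      case 2
      with that obtain v v' where vs: "vs = [v, v']"
        by (auto simp: length_Suc_conv numeral_2_eq_2)
      then have v: "v \<in> char_plane x e" "v' \<in> char_plane x e"
        using that by auto
      then have "v \<in> eta_ker x" "v' \<in> eta_ker x"
        by (simp_all add: char_plane_def)
      with that(1) x show ?thesis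
        unfolding vs 2 by (intro ideal_2_zero char_plane_isotropic[OF g e] v)
    qed
  qed
  moreover have "char_plane x e \<subseteq> TP"
    using eta_ker_subset_TP[of x] by (auto simp: char_plane_def)
  ultimately show ?thesis
    using x unfolding integral_element_def
    by (intro conjI allI impI subspace_char_plane dim_char_plane[OF g]) blast+
qed

section \<open>Ordinary and regular elements\<close>

lemma kahler_regular_0:
  assumes "x \<in> P"
  shows "kahler_regular \<I> 0 x {0}"
proof -
  have "near_frame x [] (\<lambda>y fs. integral_element \<I> 0 y (span (set fs)) \<longleftrightarrow> True)"
    unfolding near_frame_def
    by (rule exI[of _ P], rule exI[of _ 1])
       (use assms in \<open>auto simp: openin_P integral_element_0\<close>)
  then have "kahler_ordinary \<I> 0 x {0}"
    using assms unfolding kahler_ordinary_def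
    by (intro conjI exI[of _ "[]"] exI[of _ "{}"]) (simp_all add: integral_element_0)
  moreover have "near_frame x [] (\<lambda>y fs. integral_element \<I> 0 y (span (set fs)) \<longrightarrow>
      dim (polar_space \<I> 0 y (span (set fs))) = dim (polar_space \<I> 0 x {0}))"
    unfolding near_frame_def polar_space_0 dim_eta_ker
    by (rule exI[of _ P], rule exI[of _ 1]) (use assms in \<open>simp add: openin_P\<close>)
  ultimately show ?thesis
    unfolding kahler_regular_def by (intro conjI exI[of _ "[]"]) simp_all
qed

lemma eta_ker_iff: "v \<in> eta_ker x \<longleftrightarrow> v \<in> TP \<and> (\<forall>\<phi>\<in>set etas. \<phi> x [v] = 0)"
  by (simp add: eta_ker_def all_set_conv_all_nth length_etas)

text \<open>
The lines on which the \<open>\<eta>\<close> vanish are cut out by the \<open>\<eta>\<close> themselves, and their differentials are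
independent already in the directions that move the line and fix the point.
\<close>

lemma kahler_ordinary_1:
  assumes x: "x \<in> P" and e: "e \<in> eta_ker x" "e \<noteq> 0"
  shows "kahler_ordinary \<I> 1 x (span {e})"
  unfolding kahler_ordinary_def
proof (intro conjI exI[of _ "[e]"] exI[of _ "set etas"] allI impI ballI)
  show "integral_element \<I> 1 x (span {e})"
    using assms integral_element_1[OF e(2), of x] by blast
  show "length [e] = 1" "span (set [e]) = span {e}" "finite (set etas)"
    by simp_all
  show "(1, \<phi>) \<in> \<I>" if "\<phi> \<in> set etas" for \<phi>
  proof -
    obtain k where "k < 16" "\<phi> = etas ! k"
      using \<open>\<phi> \<in> set etas\<close> by (auto simp: in_set_conv_nth length_etas)
    then show ?thesis by (simp only: etas_in_ideal)
  qed
  show "near_frame x [e]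
     (\<lambda>y fs. integral_element \<I> 1 y (span (set fs)) \<longleftrightarrow> (\<forall>\<phi>\<in>set etas. \<phi> y fs = 0))"
    unfolding near_frame_def
  proof (rule exI[of _ P], rule exI[of _ "norm e"], intro conjI ballI allI impI)
    show "openin P_top P" "x \<in> P" "0 < norm e"
      using assms openin_P by simp_all
    fix y and fs :: "tvec list" assume y: "y \<in> P" and
      "length fs = length [e] \<and> set fs \<subseteq> TP \<and> (\<forall>i<length [e]. dist (fs ! i) ([e] ! i) < norm e)"
    then obtain f where f: "fs = [f]" "f \<in> TP" "dist f e < norm e"
      by (auto simp: length_Suc_conv)
    then have "f \<noteq> 0" by auto
    then show "integral_element \<I> 1 y (span (set fs)) \<longleftrightarrow> (\<forall>\<phi>\<in>set etas. \<phi> y fs = 0)"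
      using y f integral_element_1[of f y] by (simp add: eta_ker_iff)
  qed
  fix c
  assume c: "\<forall>v\<in>TP. \<forall>fs. length fs = 1 \<and> set fs \<subseteq> TP \<longrightarrow>
      (\<Sum>\<phi>\<in>set etas. c \<phi> * frame_differential \<phi> x [e] v fs) = 0"
  show "c \<phi> = 0" if "\<phi> \<in> set etas" for \<phi>
  proof -
    obtain k where k: "k < 16" "\<phi> = etas ! k"
      using \<open>\<phi> \<in> set etas\<close> by (auto simp: in_set_conv_nth length_etas)
    \<comment> \<open>For the zero vector of the base only the term moving the frame remains.\<close>
    have "f (flow 0 t x) = f (flow 0 0 x)" for t and f :: "pt \<Rightarrow> real"
      by (cases x) (simp add: flow_def zero_prod_def)
    then have "(\<lambda>t. f (flow 0 t x)) = (\<lambda>t. f (flow 0 0 x))" for f :: "pt \<Rightarrow> real"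
      by blast
    then have "Lder 0 f x = 0" for f
      by (intro Lder_eqI) (simp only: DERIV_const)
    then have fd: "frame_differential \<psi> x [e] 0 [dual_frame k] = \<psi> x [dual_frame k]" for \<psi>
      by (simp add: frame_differential_def)
    have delta: "\<psi> x [dual_frame k] = (if \<psi> = \<phi> then 1 else 0)" if \<psi>: "\<psi> \<in> set etas" for \<psi>
    proof -
      obtain j where j: "j < 16" "\<psi> = etas ! j"
        using \<psi> by (auto simp: in_set_conv_nth length_etas)
      have *: "\<psi> x [dual_frame k] = (if j = k then 1 else 0)" "\<phi> x [dual_frame k] = 1"
        using j k by (simp_all add: etas_dual_frame)
      show ?thesis
      proof (cases "j = k")
        case True
        with * j(2) k(2) show ?thesis by simp
      next
        case False
        with * have "\<psi> \<noteq> \<phi>" by auto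
        with * False show ?thesis by simp
      qed
    qed
    have "c \<psi> * frame_differential \<psi> x [e] 0 [dual_frame k] = (if \<psi> = \<phi> then c \<psi> else 0)"
      if "\<psi> \<in> set etas" for \<psi>
      by (simp only: fd delta[OF that]) simp
    then have "(\<Sum>\<psi>\<in>set etas. c \<psi> * frame_differential \<psi> x [e] 0 [dual_frame k]) =
        (\<Sum>\<psi>\<in>set etas. if \<psi> = \<phi> then c \<psi> else 0)"
      by (rule sum.cong[OF refl])
    also have "\<dots> = c \<phi>"
      using \<open>\<phi> \<in> set etas\<close> by (simp only: sum.delta' sum.delta finite_set if_True)
    finally have "c \<phi> = (\<Sum>\<psi>\<in>set etas. c \<psi> * frame_differential \<psi> x [e] 0 [dual_frame k])"
      by (rule sym)
    also have "\<dots> = 0"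
      by (rule c[rule_format]) (simp_all add: dual_frame_in_TP subspace_0[OF subspace_TP])
    finally show "c \<phi> = 0" .
  qed
qed

section \<open>Perturbation of integral lines\<close>

text \<open>
Continuity of the characteristic form in the point and the direction.
\<close>

lemma generic_open:
  assumes x: "x \<in> P" and g: "generic x e"
  shows "\<exists>U \<epsilon>. openin P_top U \<and> x \<in> U \<and> \<epsilon> > 0 \<and> (\<forall>y\<in>U. \<forall>f. dist f e < \<epsilon> \<longrightarrow> generic y f)"
proof -
  let ?S = "{p. char_form (fst p) (snd p) \<noteq> 0}"
  have "open ?S"
    unfolding char_form_def al1_def al2_def
    by (intro open_Collect_neq continuous_intros)
  moreover have "(snd (snd x), e) \<in> ?S"
    using g by (simp add: generic_def)
  ultimately obtain W V where WV: "open W" "open V" "(snd (snd x), e) \<in> W \<times> V" "W \<times> V \<subseteq> ?S"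
    by (rule open_prod_elim)
  obtain \<epsilon> where \<epsilon>: "\<epsilon> > 0" "\<And>f. dist f e < \<epsilon> \<Longrightarrow> f \<in> V"
    using WV(2,3) unfolding open_dist by blast
  have "generic y f" if "snd (snd y) \<in> W" "f \<in> V" for y f
    using WV(4) that by (auto simp: generic_def)
  with WV \<epsilon> x show ?thesis
    by (intro exI[of _ "{y \<in> P. snd (snd y) \<in> W}"] exI[of _ \<epsilon>])
       (auto intro: openin_P_top_w)
qed

lemma tendsto_vec6:
  assumes "(a \<longlongrightarrow> a') F" "(b \<longlongrightarrow> b') F" "(c \<longlongrightarrow> c') F"
    "(d \<longlongrightarrow> d') F" "(e \<longlongrightarrow> e') F" "(f \<longlongrightarrow> f') F"
  shows "((\<lambda>t. vec6 (a t) (b t) (c t) (d t) (e t) (f t)) \<longlongrightarrow> vec6 a' b' c' d' e' f') F"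
proof (rule vec_tendstoI)
  fix i :: 6
  show "((\<lambda>t. vec6 (a t) (b t) (c t) (d t) (e t) (f t) $ i) \<longlongrightarrow> vec6 a' b' c' d' e' f' $ i) F"
    using assms by (cases i rule: exhaust_6') simp_all
qed

lemma tendsto_vector_3:
  fixes a :: "'b \<Rightarrow> real"
  assumes "(a \<longlongrightarrow> a') F" "(b \<longlongrightarrow> b') F" "(c \<longlongrightarrow> c') F"
  shows "((\<lambda>t. vector [a t, b t, c t] :: real^3) \<longlongrightarrow> vector [a', b', c']) F"
proof (rule vec_tendstoI)
  fix i :: 3
  show "((\<lambda>t. (vector [a t, b t, c t] :: real^3) $ i) \<longlongrightarrow> vector [a', b', c'] $ i) F"
    using assms exhaust_3[of i] by (auto simp: vector_3)
qed

lemma eventually_poly_neq_0: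
  fixes p :: "real poly"
  assumes "p \<noteq> 0"
  shows "eventually (\<lambda>t. poly p t \<noteq> 0) (at a)"
proof -
  have "finite {t. poly p t = 0}"
    by (rule poly_roots_finite[OF assms])
  then have "open (- ({t. poly p t = 0} - {a}))"
    by (intro open_Compl finite_imp_closed) auto
  then have "eventually (\<lambda>t. t \<in> - ({t. poly p t = 0} - {a})) (nhds a)"
    by (rule eventually_nhds_in_open) simp
  then show ?thesis
    unfolding eventually_at_filter by (rule eventually_mono) auto
qed

lemma eventually_at_P_top:
  assumes "openin P_top U" "(C, u, w) \<in> U"
  shows "eventually (\<lambda>t. (C, u, w + t *\<^sub>R s) \<in> U) (at (0::real))"
proof -
  have "((\<lambda>t. w + t *\<^sub>R s) \<longlongrightarrow> w + 0 *\<^sub>R s) (at (0::real))"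
    by (intro tendsto_intros)
  then have "filterlim (\<lambda>t. w + t *\<^sub>R s) (nhds w) (at (0::real))"
    by simp
  then show ?thesis
    unfolding filterlim_iff using eventually_in_open[OF assms] by blast
qed

text \<open>
The characteristic form is moved away from zero along a line in the space of the data
\<open>(w1, w2, \<alpha>1, \<alpha>2)\<close> on which it is a nonzero polynomial; the vector is carried along by \<open>hor\<close>, so
that it stays in the kernel at the moving point.
\<close>

lemma generic_dense:
  assumes U: "openin P_top U" "x \<in> U" and e: "e \<in> eta_ker x" and \<epsilon>: "\<epsilon> > 0"
  shows "\<exists>y\<in>U. \<exists>f\<in>eta_ker y. dist f e < \<epsilon> \<and> generic y f"
proof -
  obtain C u w where x: "x = (C, u, w)" by (cases x)
  define a where "a = al1 e"
  define b where "b = al2 e"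
  define d where "d = fst (snd e)"
  \<comment> \<open>Moving \<open>(w1, w2, \<alpha>1, \<alpha>2)\<close> in the direction \<open>(1, 1, 1, 2)\<close> gives the last factor the leading
    coefficient \<open>2\<^sup>2 - 1\<^sup>2 \<noteq> 0\<close>, whatever the starting values are.\<close>
  define s :: "real^3" where "s = vector [1, 1, 0]"
  define y where "y = (\<lambda>t. (C, u, w + t *\<^sub>R s))"
  define f where "f = (\<lambda>t. hor (y t) (a + t) (b + 2 * t) d)"
  have y: "q1 (y t) = q1 x" "q2 (y t) = q2 x" "p1 (y t) = p1 x" "p2 (y t) = p2 x" "r1 (y t) = r1 x"
      "r2 (y t) = r2 x" "w1 (y t) = w1 x + t" "w2 (y t) = w2 x + t" "w3 (y t) = w3 x" for t
    by (simp_all add: y_def x s_def q1_def q2_def p1_def p2_def r1_def r2_def w1_def w2_def w3_def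
        vector_3)
  have e_hor: "e = hor x (a + 0) (b + 2 * 0) d"
    using eta_ker_eq_hor[OF e] by (simp add: a_def b_def d_def)
  have "((\<lambda>t. f t) \<longlongrightarrow> hor (y 0) (a + 0) (b + 2 * 0) d) (at 0)"
    unfolding f_def hor_def y lie_mat_def
    by (intro tendsto_Pair tendsto_vec6 tendsto_vector_3 tendsto_intros)
  moreover have "y 0 = x"
    by (simp add: y_def x)
  ultimately have "(f \<longlongrightarrow> e) (at 0)"
    using e_hor by simp
  then have ev1: "eventually (\<lambda>t. dist (f t) e < \<epsilon>) (at 0)"
    using \<epsilon> by (rule tendstoD)
  have ev2: "eventually (\<lambda>t. y t \<in> U) (at 0)"
    unfolding y_def using U by (intro eventually_at_P_top) (simp_all add: x)
  let ?p = "[:w2 x, 1:] * [:b, 2:]\<^sup>2 - [:w1 x, 1:] * [:a, 1:]\<^sup>2"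
  \<comment> \<open>The coefficient of \<open>t\<^sup>3\<close> is 3.\<close>
  have "?p \<noteq> 0"
    by (simp add: power2_eq_square)
  then have ev3: "eventually (\<lambda>t. poly ?p t \<noteq> 0) (at 0)"
    by (rule eventually_poly_neq_0)
  have ev4: "eventually (\<lambda>t. poly [:a, 1:] t \<noteq> 0) (at 0)"
    "eventually (\<lambda>t. poly [:b, 2:] t \<noteq> 0) (at 0)"
    by (intro eventually_poly_neq_0, simp)+
  have "eventually (\<lambda>t. dist (f t) e < \<epsilon> \<and> y t \<in> U \<and> poly ?p t \<noteq> 0 \<and>
      poly [:a, 1:] t \<noteq> 0 \<and> poly [:b, 2:] t \<noteq> 0) (at 0)"
    using ev1 ev2 ev3 ev4 by eventually_elim blast
  then obtain t where t: "dist (f t) e < \<epsilon>" "y t \<in> U" "poly ?p t \<noteq> 0" "poly [:a, 1:] t \<noteq> 0"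
      "poly [:b, 2:] t \<noteq> 0"
    using eventually_happens'[OF at_neq_bot] by blast
  have "poly ?p t = (w2 x + t) * (b + 2 * t)\<^sup>2 - (w1 x + t) * (a + t)\<^sup>2"
    unfolding poly_diff poly_mult poly_power by (simp add: mult.commute)
  with t(3-5) have "a + t \<noteq> 0" "b + 2 * t \<noteq> 0"
      "(w2 x + t) * (b + 2 * t)\<^sup>2 - (w1 x + t) * (a + t)\<^sup>2 \<noteq> 0"
    by (simp_all only: poly_pCons poly_0 mult_zero_right add_0_right mult_1_right mult.commute[of t] mult_1_left not_False_eq_True)
  then have "generic (y t) (f t)"
    by (simp add: generic_alt f_def hor_coordinates y)
  moreover have "f t \<in> eta_ker (y t)"
    by (simp add: f_def hor_in_eta_ker)
  ultimately show ?thesis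
    using t(1,2) by blast
qed

section \<open>Regular lines and involution\<close>

lemma generic_nonzero: "generic x e \<Longrightarrow> e \<noteq> 0"
  by (auto simp: generic_alt al1_def)

lemma dim_polar_space_1:
  assumes "x \<in> P" "e \<in> eta_ker x" "generic x e"
  shows "dim (polar_space \<I> 1 x (span {e})) = 2"
  using assms dim_char_plane[OF assms(3)] polar_space_1[OF assms(1,2)] by (simp add: generic_alt)

lemma kahler_regular_1:
  assumes x: "x \<in> P" and e: "e \<in> eta_ker x" and g: "generic x e"
  shows "kahler_regular \<I> 1 x (span {e})"
proof -
  obtain U \<epsilon> where U: "openin P_top U" "x \<in> U" "\<epsilon> > 0"
    and gen: "\<And>y f. y \<in> U \<Longrightarrow> dist f e < \<epsilon> \<Longrightarrow> generic y f"
    using generic_open[OF x g] by metis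
  have "near_frame x [e] (\<lambda>y fs. integral_element \<I> 1 y (span (set fs)) \<longrightarrow>
      dim (polar_space \<I> 1 y (span (set fs))) = dim (polar_space \<I> 1 x (span {e})))"
    unfolding near_frame_def
  proof (rule exI[of _ U], rule exI[of _ \<epsilon>], intro conjI ballI allI impI)
    fix y and fs :: "tvec list"
    assume y: "y \<in> U" and fs: "length fs = length [e] \<and> set fs \<subseteq> TP \<and>
        (\<forall>i<length [e]. dist (fs ! i) ([e] ! i) < \<epsilon>)"
      and int: "integral_element \<I> 1 y (span (set fs))"
    obtain f where f: "fs = [f]" "dist f e < \<epsilon>"
      using fs by (auto simp: length_Suc_conv)
    have gy: "generic y f"
      using gen y f(2) .
    then have "y \<in> P \<and> f \<in> eta_ker y"
      using int integral_element_1[OF generic_nonzero[OF gy], of y] f(1) by simp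
    then show "dim (polar_space \<I> 1 y (span (set fs))) = dim (polar_space \<I> 1 x (span {e}))"
      using gy x e g f(1) by (simp only: dim_polar_space_1 list.set)
  qed (use U in simp_all)
  then show ?thesis
    unfolding kahler_regular_def
    using kahler_ordinary_1[OF x e generic_nonzero[OF g]]
    by (intro conjI exI[of _ "[e]"]) simp_all
qed

lemma independence_form_eq:
  "independence_form x [v, v'] = al1 v * al2 v' - al1 v' * al2 v"
  by (simp add: independence_form_def wedge_1_1 alpha_eq)

lemma in_involution_at_generic:
  assumes x: "x \<in> P" and e: "e \<in> eta_ker x" and g: "generic x e"
  shows "in_involution_at \<I> 2 independence_form x"
proof -
  define F where "F = (\<lambda>k::nat. if k = 0 then {0} else if k = 1 then span {e} else char_plane x e)"
  have e': "e \<in> char_plane x e"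
    using e by (simp add: char_plane_def reduced_d_eta_alternating(1))
  have "integral_element \<I> k x (F k)" if "k \<le> 2" for k
  proof -
    have "k = 0 \<or> k = 1 \<or> k = 2"
      using that by linarith
    then consider "k = 0" | "k = 1" | "k = 2"
      by blast
    then show ?thesis
      using x e integral_element_0[of x] integral_element_1[OF generic_nonzero[OF g], of x]
        integral_element_2[OF x e g]
      by cases (simp_all add: F_def)
  qed
  moreover have "F k \<subseteq> F (Suc k) \<and> kahler_regular \<I> k x (F k)" if "k < 2" for k
  proof -
    have "k = 0 \<or> k = 1"
      using that by linarith
    then consider "k = 0" | "k = 1"
      by blast
    then show ?thesis
    proof cases
      case 1
      then show ?thesis
        using kahler_regular_0[OF x] by (simp add: F_def span_zero)
    next
      case 2
      have "span {e} \<subseteq> char_plane x e"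
        using e' by (intro span_minimal subspace_char_plane) simp
      then show ?thesis
        using kahler_regular_1[OF x e g] 2 by (simp add: F_def)
    qed
  qed
  ultimately have "regular_flag \<I> 2 x F"
    by (simp add: regular_flag_def)
  then have "ordinary_element \<I> 2 x (char_plane x e)"
    unfolding ordinary_element_def by (intro exI[of _ F]) (simp add: F_def)
  moreover have "nonzero_on 2 independence_form x (char_plane x e)"
  proof -
    obtain f where f: "f \<in> char_plane x e" "al1 f = 0" "al2 f = 1"
      using char_plane_surj[OF g] .
    then show ?thesis
      using e' g unfolding nonzero_on_def
      by (intro exI[of _ "[e, f]"]) (simp add: independence_form_eq generic_alt)
  qed
  ultimately show ?thesis
    unfolding in_involution_at_def by blast
qed

section \<open>The Cartan characters of regular flags\<close>

text \<open>
The line \<open>F 1\<close> itself may be characteristic. Its regularity says that the polar space has the same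
dimension for all nearby integral lines, and one of these is not characteristic.
\<close>

lemma polar_codim_values:
  assumes F: "regular_flag \<I> 2 x F"
  shows "polar_codim \<I> 2 x F 0 = 16" "polar_codim \<I> 2 x F 1 = 22" "polar_codim \<I> 2 x F 2 = 22"
proof -
  have int1: "integral_element \<I> 1 x (F 1)" and reg: "kahler_regular \<I> 1 x (F 1)"
    using F by (simp_all add: regular_flag_def)
  obtain es where es: "length es = 1" "span (set es) = F 1"
    and near: "near_frame x es (\<lambda>y fs. integral_element \<I> 1 y (span (set fs)) \<longrightarrow>
          dim (polar_space \<I> 1 y (span (set fs))) = dim (polar_space \<I> 1 x (F 1)))"
    using reg unfolding kahler_regular_def by blast
  obtain e where e: "es = [e]"
    using es(1) by (auto simp: length_Suc_conv)
  have "e \<in> F 1"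
    unfolding es(2)[symmetric] e by (simp add: span_base)
  then have ek: "e \<in> eta_ker x"
    using integral_element_subset_eta_ker[OF int1] by auto
  obtain U \<epsilon> where U: "openin P_top U" "x \<in> U" "\<epsilon> > 0"
    and *: "\<And>y fs. y \<in> U \<Longrightarrow> length fs = length es \<and> set fs \<subseteq> TP \<and>
        (\<forall>i<length es. dist (fs ! i) (es ! i) < \<epsilon>) \<Longrightarrow> integral_element \<I> 1 y (span (set fs)) \<Longrightarrow>
          dim (polar_space \<I> 1 y (span (set fs))) = dim (polar_space \<I> 1 x (F 1))"
    using near unfolding near_frame_def by blast
  obtain y f where y: "y \<in> U" "f \<in> eta_ker y" "dist f e < \<epsilon>" "generic y f"
    using generic_dense[OF U(1,2) ek U(3)] by blast
  have yP: "y \<in> P"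
    using y(1) U(1) unfolding openin_P_top by blast
  have "dim (polar_space \<I> 1 y (span (set [f]))) = dim (polar_space \<I> 1 x (F 1))"
  proof (rule *[OF y(1)])
    show "length [f] = length es \<and> set [f] \<subseteq> TP \<and> (\<forall>i<length es. dist ([f] ! i) (es ! i) < \<epsilon>)"
      using y(3) subsetD[OF eta_ker_subset_TP y(2)] by (simp add: e)
    show "integral_element \<I> 1 y (span (set [f]))"
      using integral_element_1[OF generic_nonzero[OF y(4)], of y] yP y(2) by simp
  qed
  then have "dim (polar_space \<I> 1 x (F 1)) = 2"
    using dim_polar_space_1[OF yP y(2,4)] by simp
  then show "polar_codim \<I> 2 x F 0 = 16" "polar_codim \<I> 2 x F 1 = 22" "polar_codim \<I> 2 x F 2 = 22"
    by (simp_all add: polar_codim_def polar_space_0 dim_eta_ker dim_TP)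
qed

lemma closure_w1_neq_w2: "P_top closure_of {x \<in> P. w1 x \<noteq> w2 x} = P"
proof (intro equalityI subsetI)
  fix x assume "x \<in> P_top closure_of {x \<in> P. w1 x \<noteq> w2 x}"
  then show "x \<in> P"
    by (simp add: in_closure_of topspace_P_top)
next
  fix x assume x: "x \<in> P"
  show "x \<in> P_top closure_of {x \<in> P. w1 x \<noteq> w2 x}"
    unfolding in_closure_of topspace_P_top
  proof (intro conjI allI impI x)
    fix U assume U: "x \<in> U \<and> openin P_top U"
    obtain C u w where xc: "x = (C, u, w)" by (cases x)
    define s :: "real^3" where "s = vector [1, 0, 0]"
    have "eventually (\<lambda>t. (C, u, w + t *\<^sub>R s) \<in> U) (at 0)"
      using U by (intro eventually_at_P_top) (simp_all add: xc)
    moreover have "eventually (\<lambda>t. poly [:w $ 1 - w $ 2, 1:] t \<noteq> 0) (at 0)"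
      by (rule eventually_poly_neq_0) simp
    ultimately have "eventually (\<lambda>t. (C, u, w + t *\<^sub>R s) \<in> U \<and> poly [:w $ 1 - w $ 2, 1:] t \<noteq> 0) (at 0)"
      by eventually_elim blast
    then obtain t where t: "(C, u, w + t *\<^sub>R s) \<in> U" "poly [:w $ 1 - w $ 2, 1:] t \<noteq> 0"
      using eventually_happens'[OF at_neq_bot] by blast
    moreover have "(C, u, w + t *\<^sub>R s) \<in> P"
      using t(1) U unfolding openin_P_top by blast
    ultimately show "\<exists>y. y \<in> {x \<in> P. w1 x \<noteq> w2 x} \<and> y \<in> U"
      by (intro exI[of _ "(C, u, w + t *\<^sub>R s)"]) (simp add: w1_def w2_def s_def vector_3)
  qed
qed

theorem mainTheorem4:
  shows "in_involution deformation_ideal 2 independence_form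
    \<and> general_integrals_depend_on deformation_ideal 2 independence_form 6 1"
proof
  let ?U = "{x \<in> P. w1 x \<noteq> w2 x}"
  have "openin P_top {x \<in> P. snd (snd x) \<in> {w. w $ 1 \<noteq> w $ 2}}"
    by (intro openin_P_top_w open_Collect_neq continuous_intros)
  then have "openin P_top ?U"
    by (simp add: w1_def w2_def)
  moreover have "in_involution_at \<I> 2 independence_form x" if "x \<in> ?U" for x
    using that hor_in_eta_ker
    by (intro in_involution_at_generic[of x "hor x 1 1 0"]) (auto simp: generic_alt hor_coordinates)
  ultimately show "in_involution \<I> 2 independence_form"
    unfolding in_involution_def using closure_w1_neq_w2 by blast
  show "general_integrals_depend_on \<I> 2 independence_form 6 1"
    unfolding general_integrals_depend_on_def
  proof (intro conjI ballI allI impI)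
    fix x F assume "regular_flag \<I> 2 x F \<and> nonzero_on 2 independence_form x (F 2)"
    then have F: "regular_flag \<I> 2 x F" ..
    show "cartan_character \<I> 2 x F 1 = int 6"
      using polar_codim_values[OF F] by (simp add: cartan_character_def)
    fix j :: nat assume "j \<in> {1<..2}"
    then have "j = 2" by auto
    then show "cartan_character \<I> 2 x F j = 0"
      using polar_codim_values[OF F] by (simp add: cartan_character_def)
  qed simp_all
qed

end
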